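(* Let $r\ge2$ be an integer and let $N = \begin{pmatrix} A' & B \\ J & A'^{\dagger}\end{pmatrix}$ be the $(2r+2)\times(2r+2)$ $0,1$-matrix defined in the context. The $\mathbf{cd}$-index series matrix $\Psi_N$ of the level (Eulerian) poset associated to $N$ is given by $$\Psi_N=\vec q\cdot\phi\cdot\vec q^{\,\dagger}+D,$$ where $\phi=\dfrac1{1-\mathbf c-r\mathbf d}$, $\vec q$ is the column vector with $$\vec q^{\,T}=(\mathbf c+(r-1)\mathbf d,\ \mathbf c+\mathbf d,\ \underbrace{\mathbf c,\ldots,\mathbf c}_{r-1},\ \underbrace{1,\ldots,1}_{r+1}),$$ $\vec q^{\,\dagger}$ is the row vector $$\vec q^{\,\dagger}=(\underbrace{1,\ldots,1}_{r+1},\ \underbrace{\mathbf c,\ldots,\mathbf c}_{r-1},\ \mathbf c+\mathbf d,\ \mathbf c+(r-1)\mathbf d),$$ and $$D=\begin{pmatrix}A'&B\\0&A'^{\dagger}\end{pmatrix}+\begin{pmatrix}0&F'\\0&0\end{pmatrix}\cdot\mathbf c+\begin{pmatrix}0&G\\0&0\end{pmatrix}\cdot\mathbf d .$$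
   Context: Blocks (all $(r+1)\times(r+1)$, indexed by $0\le i,j\le r$): $A'=(a'_{i,j})$ with $a'_{i,j}=1$ if ($i=0$ and $j\le r-1$) or ($i=1$ and $j=r$), and $0$ otherwise; $A'^{\dagger}$ is the reflection of $A'$ over its anti-diagonal, $(A'^{\dagger})_{i,j}=a'_{r-j,r-i}$; $B=(b_{i,j})$ with $b_{i,j}=1$ if $0\le i-j\le 1$ and $0$ otherwise; $J$ is the all-ones matrix; $F'=(f'_{i,j})$ with $f'_{i,j}=1$ if ($i=0$ and $j\le r-1$), or ($i\ge1$ and $j=r$), or $(i,j)=(1,r-1)$, and $0$ otherwise; $G=(g_{i,j})$ with $g_{0,r}=r-2$, $g_{0,r-1}=g_{1,r}=1$, and $0$ otherwise. Rows and columns of $N$ are indexed by $0,\ldots,2r+1$. The level poset associated to a $0,1$-matrix $X=(x_{i,j})$ is the ranked poset on (index set) $\times\mathbb{Z}$ with cover relations $(i,s)\prec(j,s+1)$ iff $x_{i,j}=1$. For a graded poset $P$ with rank function $\rho$, minimal element $\hat0$ and maximal element $\hat1$, the $\mathbf{ab}$-index is the polynomial in the non-commutative variables $\mathbf a,\mathbf b$ $$\Psi(P)=\sum_{c}(\mathbf a-\mathbf b)^{\rho(x_0,x_1)-1}\,\mathbf b\,(\mathbf a-\mathbf b)^{\rho(x_1,x_2)-1}\,\mathbf b\cdots\mathbf b\,(\mathbf a-\mathbf b)^{\rho(x_k,x_{k+1})-1},$$ the sum being over all chains $c=\{\hat0=x_0<x_1<\cdots<x_k<x_{k+1}=\hat1\}$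 ($k\ge0$), where $\rho(x,y)=\rho(y)-\rho(x)$. For Eulerian $P$ it is a polynomial in $\mathbf c=\mathbf a+\mathbf b$ and $\mathbf d=\mathbf a\mathbf b+\mathbf b\mathbf a$, called the $\mathbf{cd}$-index. For a level poset, $\Psi_N=(\Psi_{i,j})$ is the matrix with entries the formal series $\Psi_{i,j}=\sum_{k\ge1}\Psi([(i,0),(j,k)])$ in $\mathbb{Z}\langle\langle\mathbf a,\mathbf b\rangle\rangle$, where the term is $0$ when $(i,0)\not\le(j,k)$. The identity is understood with $\mathbf c=\mathbf a+\mathbf b$, $\mathbf d=\mathbf a\mathbf b+\mathbf b\mathbf a$, and $\frac1{1-u}=\sum_{k\ge0}u^k$ for a series $u$ without constant term; products are non-commutative, so the $(i,j)$ entry of $\vec q\cdot\phi\cdot\vec q^{\,\dagger}$ is $(\vec q)_i\,\phi\,(\vec q^{\,\dagger})_j$. *)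

theory Defs
  imports "Jordan_Normal_Form.Matrix" "HOL-Library.Groups_Big_Fun"
begin

subsection \<open>Formal power series in two non-commuting variables\<close>

datatype letter = LA | LB

text \<open>A series over the integers is the family of its coefficients, indexed by words.\<close>

typedef ab_series = "UNIV :: (letter list \<Rightarrow> int) set"
  morphisms ab_coeff Abs_ab_series
  by simp

setup_lifting type_definition_ab_series

lemma ab_series_eqI: "(\<And>w. ab_coeff f w = ab_coeff g w) \<Longrightarrow> f = g"
  by (simp add: ab_coeff_inject[symmetric] fun_eq_iff)

instantiation ab_series :: ab_group_add
begin

lift_definition zero_ab_series :: ab_series is "\<lambda>w. 0" .
lift_definition plus_ab_series :: "ab_series \<Rightarrow> ab_series \<Rightarrow> ab_series"
  is "\<lambda>f g w. f w + g w" .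
lift_definition minus_ab_series :: "ab_series \<Rightarrow> ab_series \<Rightarrow> ab_series"
  is "\<lambda>f g w. f w - g w" .
lift_definition uminus_ab_series :: "ab_series \<Rightarrow> ab_series"
  is "\<lambda>f w. - f w" .

instance
  by standard (transfer; simp add: fun_eq_iff)+

end

instantiation ab_series :: ring_1
begin

lift_definition one_ab_series :: ab_series is "\<lambda>w. if w = [] then 1 else 0" .
lift_definition times_ab_series :: "ab_series \<Rightarrow> ab_series \<Rightarrow> ab_series"
  is "\<lambda>f g w. \<Sum>k\<le>length w. f (take k w) * g (drop k w)" .

instance
proof
  fix f g h :: ab_series
  show "f * g * h = f * (g * h)"
  proof (transfer, rule ext)
    fix f g h :: "letter list \<Rightarrow> int" and w :: "letter list"
    let ?n = "length w"
    let ?t = "\<lambda>i k. f (take i w) * g (drop i (take k w)) * h (drop k w)"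
    have "(\<Sum>k\<le>?n. (\<Sum>i\<le>length (take k w). f (take i (take k w)) * g (drop i (take k w))) * h (drop k w))
        = (\<Sum>k\<le>?n. \<Sum>i\<le>k. ?t i k)"
      by (intro sum.cong refl) (auto simp: sum_distrib_right min_def intro!: sum.cong)
    also have "\<dots> = (\<Sum>(k, i)\<in>Sigma {..?n} (\<lambda>k. {..k}). ?t i k)"
      by (subst sum.Sigma) auto
    also have "\<dots> = (\<Sum>(i, j)\<in>Sigma {..?n} (\<lambda>i. {..?n - i}). ?t i (i + j))"
      by (rule sum.reindex_bij_witness[where i = "\<lambda>(i, j). (i + j, i)" and j = "\<lambda>(k, i). (i, k - i)"]) auto
    also have "\<dots> = (\<Sum>i\<le>?n. \<Sum>j\<le>?n - i. ?t i (i + j))"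
      by (subst sum.Sigma) auto
    also have "\<dots> = (\<Sum>i\<le>?n. f (take i w) *
        (\<Sum>j\<le>length (drop i w). g (take j (drop i w)) * h (drop j (drop i w))))"
      by (intro sum.cong refl)
        (simp add: sum_distrib_left mult.assoc drop_take add.commute)
    finally show "(\<Sum>k\<le>?n. (\<Sum>i\<le>length (take k w). f (take i (take k w)) * g (drop i (take k w))) * h (drop k w))
      = (\<Sum>i\<le>?n. f (take i w) *
        (\<Sum>j\<le>length (drop i w). g (take j (drop i w)) * h (drop j (drop i w))))" .
  qed
  show "1 * f = f"
  proof (transfer, rule ext)
    fix f :: "letter list \<Rightarrow> int" and w :: "letter list"
    have "(\<Sum>k\<le>length w. (if take k w = [] then 1 else 0) * f (drop k w))
        = (\<Sum>k\<in>{0}. (if take k w = [] then 1 else 0) * f (drop k w))"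
      by (rule sum.mono_neutral_right) auto
    then show "(\<Sum>k\<le>length w. (if take k w = [] then 1 else 0) * f (drop k w)) = f w"
      by simp
  qed
  show "f * 1 = f"
  proof (transfer, rule ext)
    fix f :: "letter list \<Rightarrow> int" and w :: "letter list"
    have "(\<Sum>k\<le>length w. f (take k w) * (if drop k w = [] then 1 else 0))
        = (\<Sum>k\<in>{length w}. f (take k w) * (if drop k w = [] then 1 else 0))"
      by (rule sum.mono_neutral_right) auto
    then show "(\<Sum>k\<le>length w. f (take k w) * (if drop k w = [] then 1 else 0)) = f w"
      by simp
  qed
  show "(f + g) * h = f * h + g * h"
    by transfer (simp add: fun_eq_iff distrib_right sum.distrib)
  show "f * (g + h) = f * g + f * h"
    by transfer (simp add: fun_eq_iff distrib_left sum.distrib)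
  show "(0 :: ab_series) \<noteq> 1"
    by transfer (auto simp: fun_eq_iff)
qed

end

lift_definition avar :: ab_series is "\<lambda>w. if w = [LA] then 1 else 0" .
lift_definition bvar :: ab_series is "\<lambda>w. if w = [LB] then 1 else 0" .

definition cvar :: ab_series where "cvar = avar + bvar"
definition dvar :: ab_series where "dvar = avar * bvar + bvar * avar"

text \<open>The coefficientwise sum of a locally finite family: it is meaningful when, for every word
  \<open>w\<close>, only finitely many \<open>f k\<close> have a nonzero coefficient at \<open>w\<close> (otherwise
  \<^const>\<open>Sum_any\<close> yields the default value 0 at \<open>w\<close>).\<close>

lift_definition formal_sum :: "(nat \<Rightarrow> ab_series) \<Rightarrow> ab_series"
  is "\<lambda>f w. Sum_any (\<lambda>k. f k w)" .

text \<open>\<open>1 / (1 - u)\<close>, for a series \<open>u\<close> without constant term.\<close>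

definition inv_one_minus :: "ab_series \<Rightarrow> ab_series" where
  "inv_one_minus u = formal_sum (\<lambda>k. u ^ k)"


subsection \<open>The ab-index of a graded poset\<close>

text \<open>Here \<open>P\<close> is the set of elements and \<open>R\<close> the (reflexive) order relation;
  the endpoints \<open>lo\<close> and \<open>hi\<close>, the minimum and maximum of \<open>P\<close> are
  the first and last members of a chain, which is listed in increasing order.\<close>

definition bounded_chains :: "'p set \<Rightarrow> 'p rel \<Rightarrow> 'p \<Rightarrow> 'p \<Rightarrow> 'p list set" where
  "bounded_chains P R lo hi =
     {xs. set xs \<subseteq> P \<and> sorted_wrt (\<lambda>x y. (x, y) \<in> R \<and> x \<noteq> y) xs \<and>
          2 \<le> length xs \<and> hd xs = lo \<and> last xs = hi}"

fun chain_weight :: "('p \<Rightarrow> int) \<Rightarrow> 'p list \<Rightarrow> ab_series" where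
  "chain_weight \<rho> [] = 1"
| "chain_weight \<rho> [x] = 1"
| "chain_weight \<rho> [x, y] = (avar - bvar) ^ nat (\<rho> y - \<rho> x - 1)"
| "chain_weight \<rho> (x # y # z # xs) =
     (avar - bvar) ^ nat (\<rho> y - \<rho> x - 1) * bvar * chain_weight \<rho> (y # z # xs)"

definition ab_index :: "'p set \<Rightarrow> 'p rel \<Rightarrow> ('p \<Rightarrow> int) \<Rightarrow> 'p \<Rightarrow> 'p \<Rightarrow> ab_series" where
  "ab_index P R \<rho> lo hi = (\<Sum>xs\<in>bounded_chains P R lo hi. chain_weight \<rho> xs)"


subsection \<open>Level posets\<close>

definition level_cover :: "int mat \<Rightarrow> (nat \<times> int) rel" where
  "level_cover X = {((i, s), (j, s + 1)) | i j s.
     i < dim_row X \<and> j < dim_col X \<and> X $$ (i, j) = 1}"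

definition level_le :: "int mat \<Rightarrow> (nat \<times> int) rel" where
  "level_le X = (level_cover X)\<^sup>*"

definition level_interval :: "int mat \<Rightarrow> nat \<times> int \<Rightarrow> nat \<times> int \<Rightarrow> (nat \<times> int) set" where
  "level_interval X x y = {z. (x, z) \<in> level_le X \<and> (z, y) \<in> level_le X}"

text \<open>Covers raise the second component by one, so the rank function is \<^const>\<open>snd\<close>.\<close>

definition level_series :: "int mat \<Rightarrow> nat \<Rightarrow> nat \<Rightarrow> ab_series" where
  "level_series X i j = formal_sum (\<lambda>k.
     if 1 \<le> k \<and> ((i, 0), (j, int k)) \<in> level_le X
     then ab_index (level_interval X (i, 0) (j, int k)) (level_le X) snd (i, 0) (j, int k)
     else 0)"

definition level_series_mat :: "int mat \<Rightarrow> ab_series mat" where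
  "level_series_mat X = mat (dim_row X) (dim_col X) (\<lambda>(i, j). level_series X i j)"


subsection \<open>The blocks\<close>

definition block_A :: "nat \<Rightarrow> int mat" where
  "block_A r = mat (r + 1) (r + 1) (\<lambda>(i, j).
     if (i = 0 \<and> j \<le> r - 1) \<or> (i = 1 \<and> j = r) then 1 else 0)"

definition block_A_dagger :: "nat \<Rightarrow> int mat" where
  "block_A_dagger r = mat (r + 1) (r + 1) (\<lambda>(i, j). block_A r $$ (r - j, r - i))"

definition block_B :: "nat \<Rightarrow> int mat" where
  "block_B r = mat (r + 1) (r + 1) (\<lambda>(i, j). if 0 \<le> int i - int j \<and> int i - int j \<le> 1 then 1 else 0)"

definition block_J :: "nat \<Rightarrow> int mat" where
  "block_J r = mat (r + 1) (r + 1) (\<lambda>_. 1)"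

definition block_F :: "nat \<Rightarrow> int mat" where
  "block_F r = mat (r + 1) (r + 1) (\<lambda>(i, j).
     if (i = 0 \<and> j \<le> r - 1) \<or> (1 \<le> i \<and> j = r) \<or> (i = 1 \<and> j = r - 1) then 1 else 0)"

definition block_G :: "nat \<Rightarrow> int mat" where
  "block_G r = mat (r + 1) (r + 1) (\<lambda>(i, j).
     if i = 0 \<and> j = r then int r - 2
     else if (i = 0 \<and> j = r - 1) \<or> (i = 1 \<and> j = r) then 1 else 0)"

definition block_N :: "nat \<Rightarrow> int mat" where
  "block_N r = four_block_mat (block_A r) (block_B r) (block_J r) (block_A_dagger r)"

definition series_mat :: "int mat \<Rightarrow> ab_series mat" where
  "series_mat M = map_mat of_int M"

definition mat_times :: "ab_series mat \<Rightarrow> ab_series \<Rightarrow> ab_series mat" where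
  "mat_times M u = map_mat (\<lambda>x. x * u) M"

text \<open>The column and row vectors are rectangular matrices, so that their products with the
  1-by-1 matrix of \<open>\<phi>\<close> are products of matrices over the non-commutative ring of series.\<close>

definition q_col :: "nat \<Rightarrow> ab_series mat" where
  "q_col r = mat_of_cols (2 * r + 2) [vec_of_list
     ([cvar + of_nat (r - 1) * dvar, cvar + dvar] @ replicate (r - 1) cvar @ replicate (r + 1) 1)]"

definition q_row :: "nat \<Rightarrow> ab_series mat" where
  "q_row r = mat_of_rows (2 * r + 2) [vec_of_list
     (replicate (r + 1) 1 @ replicate (r - 1) cvar @ [cvar + dvar, cvar + of_nat (r - 1) * dvar])]"

definition phi :: "nat \<Rightarrow> ab_series" where
  "phi r = inv_one_minus (cvar + of_nat r * dvar)"

definition D_mat :: "nat \<Rightarrow> ab_series mat" where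
  "D_mat r = (let Z = 0\<^sub>m (r + 1) (r + 1) in
     series_mat (four_block_mat (block_A r) (block_B r) Z (block_A_dagger r))
     + mat_times (series_mat (four_block_mat Z (block_F r) Z Z)) cvar
     + mat_times (series_mat (four_block_mat Z (block_G r) Z Z)) dvar)"

end

theory Submission
  imports Defs
begin

text \<open>Write \<open>t = a - b\<close>. Splitting a chain at its second element gives \<open>\<Psi> = K + K b \<Psi>\<close>, where \<open>K\<close>
  has the entries \<open>\<Sum>\<^sub>k t\<^sup>k\<close>, summed over those \<open>k\<close> for which \<open>N\<close> has a walk of length \<open>k + 1\<close>. In
  the Boolean sense \<open>N\<^sup>k\<close> is the all-ones matrix \<open>J\<close> for every \<open>k \<ge> 3\<close>, so
  \<open>M = (1 - t) K = (1 - t) N + (t - t\<^sup>2) N\<^sup>2 + t\<^sup>2 J\<close> is explicit, and \<open>\<Psi>\<close> is the only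
  solution of \<open>(1 - t) \<Psi> = M (1 + b \<Psi>)\<close>. The claimed matrix is a solution: there is a column
  \<open>u\<close> with \<open>(1 - t) q - M b q = u (1 - c - r d)\<close> and \<open>u q\<^sup>\<dagger> + (1 - t) D = M (1 + b D)\<close>, namely
  \<open>u = (a, t (1 + b), \<dots>, t (1 + b), 1 + b, \<dots>, 1 + b)\<close>.\<close>

subsection \<open>Degrees and formal sums of series\<close>

lemma ab_coeff_add [simp]: "ab_coeff (f + g) w = ab_coeff f w + ab_coeff g w"
  by transfer simp

lemma ab_coeff_zero [simp]: "ab_coeff 0 w = 0"
  by transfer simp

lemma ab_coeff_diff [simp]: "ab_coeff (f - g) w = ab_coeff f w - ab_coeff g w"
  by transfer simp

lemma ab_coeff_one: "ab_coeff 1 w = (if w = [] then 1 else 0)"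
  by transfer simp

lemma ab_coeff_mult: "ab_coeff (f * g) w = (\<Sum>k\<le>length w. ab_coeff f (take k w) * ab_coeff g (drop k w))"
  by transfer simp

lemma ab_coeff_sum: "ab_coeff (\<Sum>i\<in>A. f i) w = (\<Sum>i\<in>A. ab_coeff (f i) w)"
  by (induction A rule: infinite_finite_induct) auto

text \<open>Membership in the \<open>n\<close>-th power of the ideal of series without constant
  term; for \<open>n = 1\<close> this is the condition under which \<open>1 / (1 - u)\<close> is
  meaningful.\<close>

definition vanishes_below :: "nat \<Rightarrow> ab_series \<Rightarrow> bool" where
  "vanishes_below n f \<longleftrightarrow> (\<forall>w. length w < n \<longrightarrow> ab_coeff f w = 0)"

text \<open>A word of length less than \<open>m + n\<close> cannot be cut into a prefix of length at
  least \<open>m\<close> and a suffix of length at least \<open>n\<close>, so every summand of the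
  coefficient has a zero factor.\<close>

lemma vanishes_below_mult:
  assumes "vanishes_below m f" "vanishes_below n g"
  shows "vanishes_below (m + n) (f * g)"
  unfolding vanishes_below_def
proof (intro allI impI)
  fix w :: "letter list" assume w: "length w < m + n"
  have "ab_coeff f (take k w) * ab_coeff g (drop k w) = 0" if "k \<le> length w" for k
  proof (cases "k < m")
    case True
    with assms(1) that show ?thesis by (simp add: vanishes_below_def)
  next
    case False
    with assms(2) that w show ?thesis by (simp add: vanishes_below_def)
  qed
  then show "ab_coeff (f * g) w = 0" by (auto simp: ab_coeff_mult intro!: sum.neutral)
qed

lemma vanishes_below_0 [simp]: "vanishes_below 0 f"
  by (simp add: vanishes_below_def)

lemma vanishes_below_add:
  "vanishes_below n f \<Longrightarrow> vanishes_below n g \<Longrightarrow> vanishes_below n (f + g)"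
  by (simp add: vanishes_below_def)

lemma vanishes_below_diff:
  "vanishes_below n f \<Longrightarrow> vanishes_below n g \<Longrightarrow> vanishes_below n (f - g)"
  by (simp add: vanishes_below_def)

lemma vanishes_below_sum:
  "(\<And>i. i \<in> A \<Longrightarrow> vanishes_below n (f i)) \<Longrightarrow> vanishes_below n (\<Sum>i\<in>A. f i)"
  by (simp add: vanishes_below_def ab_coeff_sum)

lemma vanishes_below_power: "vanishes_below 1 u \<Longrightarrow> vanishes_below k (u ^ k)"
proof (induction k)
  case (Suc k)
  then show ?case using vanishes_below_mult[of 1 u k "u ^ k"] by simp
qed simp

lemma vanishes_below_avar: "vanishes_below 1 avar"
  unfolding vanishes_below_def by transfer auto

lemma vanishes_below_bvar: "vanishes_below 1 bvar"
  unfolding vanishes_below_def by transfer auto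

lemma vanishes_below_mult_left: "vanishes_below n g \<Longrightarrow> vanishes_below n (f * g)"
  using vanishes_below_mult[of 0 f n g] by simp

lemma vanishes_below_cvar: "vanishes_below 1 cvar"
  unfolding cvar_def by (intro vanishes_below_add vanishes_below_avar vanishes_below_bvar)

lemma vanishes_below_dvar: "vanishes_below 1 dvar"
  unfolding dvar_def
  by (intro vanishes_below_add vanishes_below_mult_left vanishes_below_avar vanishes_below_bvar)

section \<open>Locally finite families, formal sums and the geometric series\<close>

definition locally_finite :: "(nat \<Rightarrow> ab_series) \<Rightarrow> bool" where
  "locally_finite f \<longleftrightarrow> (\<forall>w. finite {k. ab_coeff (f k) w \<noteq> 0})"

lemma locally_finiteI:
  assumes "\<And>k. vanishes_below k (f k)"
  shows "locally_finite f"
  unfolding locally_finite_def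
proof
  fix w :: "letter list"
  have "{k. ab_coeff (f k) w \<noteq> 0} \<subseteq> {..length w}"
    using assms by (force simp: vanishes_below_def not_less[symmetric])
  then show "finite {k. ab_coeff (f k) w \<noteq> 0}" by (rule finite_subset) simp
qed

lemma locally_finite_Suc_iff: "locally_finite (\<lambda>k. f (Suc k)) \<longleftrightarrow> locally_finite f"
proof -
  have "finite {k. ab_coeff (f (Suc k)) w \<noteq> 0} \<longleftrightarrow> finite {k. ab_coeff (f k) w \<noteq> 0}" for w
  proof
    assume "finite {k. ab_coeff (f (Suc k)) w \<noteq> 0}"
    then have "finite (insert 0 (Suc ` {k. ab_coeff (f (Suc k)) w \<noteq> 0}))" by simp
    moreover have "{k. ab_coeff (f k) w \<noteq> 0} \<subseteq> insert 0 (Suc ` {k. ab_coeff (f (Suc k)) w \<noteq> 0})"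
    proof
      fix k assume "k \<in> {k. ab_coeff (f k) w \<noteq> 0}"
      then show "k \<in> insert 0 (Suc ` {k. ab_coeff (f (Suc k)) w \<noteq> 0})" by (cases k) auto
    qed
    ultimately show "finite {k. ab_coeff (f k) w \<noteq> 0}" by (rule rev_finite_subset)
  next
    assume "finite {k. ab_coeff (f k) w \<noteq> 0}"
    from finite_vimageI[OF this, of Suc] show "finite {k. ab_coeff (f (Suc k)) w \<noteq> 0}"
      by (simp add: vimage_def)
  qed
  then show ?thesis by (simp add: locally_finite_def)
qed

lemma ab_coeff_formal_sum: "ab_coeff (formal_sum f) w = Sum_any (\<lambda>k. ab_coeff (f k) w)"
  by transfer simp

lemma formal_sum_Suc:
  assumes "locally_finite f"
  shows "formal_sum f = f 0 + formal_sum (\<lambda>k. f (Suc k))"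
proof (rule ab_series_eqI)
  fix w
  let ?c = "\<lambda>k. ab_coeff (f k) w"
  have fin: "finite {k. ?c (Suc k) \<noteq> 0}"
    using assms locally_finite_Suc_iff[of f] by (simp add: locally_finite_def)
  \<comment> \<open>The index 0 is put into the support even if its term vanishes, so that it can be
    split off without a case distinction.\<close>
  have "Sum_any ?c = sum ?c (insert 0 (Suc ` {k. ?c (Suc k) \<noteq> 0}))"
  proof (rule Sum_any.expand_superset)
    show "{k. ?c k \<noteq> 0} \<subseteq> insert 0 (Suc ` {k. ?c (Suc k) \<noteq> 0})"
    proof
      fix k assume "k \<in> {k. ?c k \<noteq> 0}"
      then show "k \<in> insert 0 (Suc ` {k. ?c (Suc k) \<noteq> 0})" by (cases k) auto
    qed
  qed (use fin in simp)
  also have "\<dots> = ?c 0 + (\<Sum>k | ?c (Suc k) \<noteq> 0. ?c (Suc k))"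
    using fin by (subst sum.insert) (auto simp: sum.reindex)
  finally show "ab_coeff (formal_sum f) w = ab_coeff (f 0 + formal_sum (\<lambda>k. f (Suc k))) w"
    by (simp add: ab_coeff_formal_sum Sum_any.expand_set)
qed

text \<open>The coefficient of \<open>u * f k\<close> at \<open>w\<close> uses \<open>f k\<close>
  only at the finitely many suffixes of \<open>w\<close>. Hence one finite set \<open>S\<close> of
  indices carries all the sums involved, and finite sums may be exchanged.\<close>

lemma formal_sum_mult_left:
  assumes "locally_finite f"
  shows "formal_sum (\<lambda>k. u * f k) = u * formal_sum f"
proof (rule ab_series_eqI)
  fix w
  define S where "S = (\<Union>i\<le>length w. {k. ab_coeff (f k) (drop i w) \<noteq> 0})"
  have S: "finite S"
    using assms by (auto simp: S_def locally_finite_def)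
  have "ab_coeff (formal_sum (\<lambda>k. u * f k)) w = (\<Sum>k\<in>S. ab_coeff (u * f k) w)"
    unfolding ab_coeff_formal_sum
  proof (rule Sum_any.expand_superset[OF S], rule subsetI, rule ccontr)
    fix k assume "k \<in> {k. ab_coeff (u * f k) w \<noteq> 0}" "k \<notin> S"
    then show False by (simp add: S_def ab_coeff_mult)
  qed
  also have "\<dots> = (\<Sum>i\<le>length w. ab_coeff u (take i w) * (\<Sum>k\<in>S. ab_coeff (f k) (drop i w)))"
    unfolding ab_coeff_mult by (subst sum.swap) (simp add: sum_distrib_left)
  also have "\<dots> = ab_coeff (u * formal_sum f) w"
    unfolding ab_coeff_mult ab_coeff_formal_sum
    by (intro sum.cong refl arg_cong2[where f = "(*)"] Sum_any.expand_superset[symmetric] S)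
      (auto simp: S_def)
  finally show "ab_coeff (formal_sum (\<lambda>k. u * f k)) w = ab_coeff (u * formal_sum f) w" .
qed

text \<open>The term \<open>k = 0\<close> of the geometric series is split off. Rearranged,
  \<open>inv_one_minus u\<close> is a right inverse of \<open>1 - u\<close>.\<close>

lemma inv_one_minus_unfold:
  assumes "vanishes_below 1 u"
  shows "inv_one_minus u = 1 + u * inv_one_minus u"
proof -
  have lf: "locally_finite (\<lambda>k. u ^ k)"
    by (intro locally_finiteI vanishes_below_power assms)
  show ?thesis
    using formal_sum_Suc[OF lf] formal_sum_mult_left[OF lf, of u]
    by (simp add: inv_one_minus_def)
qed

section \<open>Homogeneous series and products of graded sums\<close>

definition homogeneous :: "nat \<Rightarrow> ab_series \<Rightarrow> bool" where
  "homogeneous n f \<longleftrightarrow> (\<forall>w. length w \<noteq> n \<longrightarrow> ab_coeff f w = 0)"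

lemma homogeneous_zero [simp]: "homogeneous n 0"
  by (simp add: homogeneous_def)

lemma homogeneous_one: "homogeneous 0 1"
  by (auto simp: homogeneous_def ab_coeff_one)

lemma homogeneous_add: "homogeneous n f \<Longrightarrow> homogeneous n g \<Longrightarrow> homogeneous n (f + g)"
  by (simp add: homogeneous_def)

lemma homogeneous_diff: "homogeneous n f \<Longrightarrow> homogeneous n g \<Longrightarrow> homogeneous n (f - g)"
  by (simp add: homogeneous_def)

lemma homogeneous_sum:
  "(\<And>i. i \<in> A \<Longrightarrow> homogeneous n (f i)) \<Longrightarrow> homogeneous n (\<Sum>i\<in>A. f i)"
  by (simp add: homogeneous_def ab_coeff_sum)

lemma homogeneous_mult:
  assumes "homogeneous m f" "homogeneous n g" "p = m + n"
  shows "homogeneous p (f * g)"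
  unfolding homogeneous_def
proof (intro allI impI)
  fix w :: "letter list" assume w: "length w \<noteq> p"
  have "ab_coeff f (take k w) * ab_coeff g (drop k w) = 0" if "k \<le> length w" for k
  proof (cases "k = m")
    case True
    with assms(2,3) that w show ?thesis by (simp add: homogeneous_def)
  next
    case False
    with assms(1) that show ?thesis by (simp add: homogeneous_def)
  qed
  then show "ab_coeff (f * g) w = 0" by (auto simp: ab_coeff_mult intro!: sum.neutral)
qed

lemma homogeneous_power: "homogeneous 1 f \<Longrightarrow> homogeneous k (f ^ k)"
  by (induction k) (auto intro: homogeneous_one homogeneous_mult)

lemma homogeneous_avar: "homogeneous 1 avar"
  unfolding homogeneous_def by transfer auto

lemma homogeneous_bvar: "homogeneous 1 bvar"
  unfolding homogeneous_def by transfer auto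

lemma homogeneous_imp_vanishes_below: "homogeneous n f \<Longrightarrow> vanishes_below n f"
  by (auto simp: homogeneous_def vanishes_below_def)

text \<open>Only the term of degree \<open>length w\<close> can be nonzero at \<open>w\<close>, so
  the infinite sum collapses and later identities of formal sums can be compared degree by
  degree.\<close>

lemma ab_coeff_formal_sum_homogeneous:
  assumes "\<And>k. homogeneous k (f k)"
  shows "ab_coeff (formal_sum f) w = ab_coeff (f (length w)) w"
proof -
  have "Sum_any (\<lambda>k. ab_coeff (f k) w) = (\<Sum>k\<in>{length w}. ab_coeff (f k) w)"
    by (rule Sum_any.expand_superset) (use assms in \<open>auto simp: homogeneous_def, metis\<close>)
  then show ?thesis by (simp add: ab_coeff_formal_sum)
qed

lemma formal_sum_add:
  assumes "locally_finite f" "locally_finite g"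
  shows "formal_sum (\<lambda>k. f k + g k) = formal_sum f + formal_sum g"
  using assms
  by (intro ab_series_eqI) (simp add: ab_coeff_formal_sum locally_finite_def Sum_any.distrib)

lemma formal_sum_sum:
  assumes "finite A" "\<And>i k. i \<in> A \<Longrightarrow> homogeneous k (f i k)"
  shows "formal_sum (\<lambda>k. \<Sum>i\<in>A. f i k) = (\<Sum>i\<in>A. formal_sum (f i))"
  using assms
  by (intro ab_series_eqI) (simp add: ab_coeff_formal_sum_homogeneous ab_coeff_sum homogeneous_sum)

text \<open>Cutting \<open>w\<close> after \<open>s\<close> letters leaves only the components
  \<open>f s\<close> and \<open>g (length w - s)\<close>, on both sides of the equation.\<close>

lemma formal_sum_Cauchy_product:
  assumes f: "\<And>k. homogeneous k (f k)" and g: "\<And>k. homogeneous k (g k)"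
  shows "formal_sum (\<lambda>k. \<Sum>s\<le>k. f s * g (k - s)) = formal_sum f * formal_sum g"
proof (rule ab_series_eqI)
  fix w
  have "homogeneous k (\<Sum>s\<le>k. f s * g (k - s))" for k
    by (intro homogeneous_sum homogeneous_mult[OF f g]) auto
  then have "ab_coeff (formal_sum (\<lambda>k. \<Sum>s\<le>k. f s * g (k - s))) w
      = (\<Sum>s\<le>length w. ab_coeff (f s * g (length w - s)) w)"
    by (simp add: ab_coeff_formal_sum_homogeneous ab_coeff_sum)
  also have "\<dots> = (\<Sum>s\<le>length w. ab_coeff (f s) (take s w) * ab_coeff (g (length w - s)) (drop s w))"
  proof (intro sum.cong refl)
    fix s assume s: "s \<in> {..length w}"
    have "ab_coeff (f s * g (length w - s)) w
        = (\<Sum>k\<in>{s}. ab_coeff (f s) (take k w) * ab_coeff (g (length w - s)) (drop k w))"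
      unfolding ab_coeff_mult
      by (rule sum.mono_neutral_right) (use s f in \<open>auto simp: homogeneous_def\<close>)
    then show "ab_coeff (f s * g (length w - s)) w
        = ab_coeff (f s) (take s w) * ab_coeff (g (length w - s)) (drop s w)"
      by simp
  qed
  also have "\<dots> = ab_coeff (formal_sum f * formal_sum g) w"
    unfolding ab_coeff_mult
    by (intro sum.cong refl) (simp add: ab_coeff_formal_sum_homogeneous f g)
  finally show "ab_coeff (formal_sum (\<lambda>k. \<Sum>s\<le>k. f s * g (k - s))) w
      = ab_coeff (formal_sum f * formal_sum g) w" .
qed

text \<open>A contraction argument: the difference of two solutions is mapped to itself by
  \<open>T\<close>, which raises the order by at least one, so the difference vanishes below every
  degree.\<close>

lemma linear_system_unique:
  fixes T :: "nat \<Rightarrow> nat \<Rightarrow> ab_series"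
  assumes T: "\<And>i k. vanishes_below 1 (T i k)"
    and Y: "\<And>i. i < n \<Longrightarrow> Y i = g i + (\<Sum>k<n. T i k * Y k)"
    and Z: "\<And>i. i < n \<Longrightarrow> Z i = g i + (\<Sum>k<n. T i k * Z k)"
    and "i < n"
  shows "Y i = Z i"
proof -
  have "vanishes_below m (Y i - Z i)" if "i < n" for m i
    using that
  proof (induction m arbitrary: i)
    case (Suc m)
    have "Y i - Z i = (\<Sum>k<n. T i k * (Y k - Z k))"
      using Y[OF Suc.prems] Z[OF Suc.prems] by (simp add: sum_subtractf right_diff_distrib)
    moreover have "vanishes_below (1 + m) (T i k * (Y k - Z k))" if "k < n" for k
      by (intro vanishes_below_mult T Suc.IH that)
    ultimately show ?case by (auto intro: vanishes_below_sum)
  qed simp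
  then have "ab_coeff (Y i - Z i) w = 0" for w
    using \<open>i < n\<close> by (auto simp: vanishes_below_def intro: lessI)
  then show ?thesis by (intro ab_series_eqI) simp
qed

subsection \<open>Chains in level posets\<close>

text \<open>The directed graph whose arcs are the entries 1 of \<open>X\<close>; the
  \<open>k\<close>-th relational power describes the walks of length \<open>k\<close>.\<close>

definition level_edges :: "int mat \<Rightarrow> nat rel" where
  "level_edges X = {(i, j). i < dim_row X \<and> j < dim_col X \<and> X $$ (i, j) = 1}"

text \<open>Every cover raises the level by exactly one. Forgetting the levels of a saturated chain
  gives a walk, and a walk together with its starting level determines the levels.\<close>

lemma level_le_iff:
  "((i, s), (j, t)) \<in> level_le X \<longleftrightarrow> s \<le> t \<and> (i, j) \<in> level_edges X ^^ nat (t - s)"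
proof
  assume "((i, s), (j, t)) \<in> level_le X"
  then show "s \<le> t \<and> (i, j) \<in> level_edges X ^^ nat (t - s)"
    unfolding level_le_def
  proof (induction "(j, t)" arbitrary: j t rule: rtrancl_induct)
    case (step y)
    obtain l where y: "y = (l, t - 1)" and e: "(l, j) \<in> level_edges X"
      using step.hyps(2) by (auto simp: level_cover_def level_edges_def)
    from step.hyps(3)[OF y] have "s \<le> t - 1" "(i, l) \<in> level_edges X ^^ nat (t - 1 - s)"
      by auto
    moreover have "nat (t - s) = Suc (nat (t - 1 - s))"
      using \<open>s \<le> t - 1\<close> by simp
    ultimately show ?case using e by auto
  qed auto
next
  have "(i, j) \<in> level_edges X ^^ k \<Longrightarrow> ((i, s), (j, s + int k)) \<in> level_le X" for k
  proof (induction k arbitrary: j)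
    case (Suc k)
    then obtain l where "(i, l) \<in> level_edges X ^^ k" and e: "(l, j) \<in> level_edges X" by auto
    from Suc.IH[OF this(1)] have "((i, s), (l, s + int k)) \<in> level_le X" .
    moreover have "((l, s + int k), (j, s + int k + 1)) \<in> level_cover X"
      using e by (auto simp: level_cover_def level_edges_def)
    ultimately show ?case
      by (auto simp: level_le_def add.commute add.left_commute intro: rtrancl_into_rtrancl)
  qed (simp add: level_le_def)
  from this[of "nat (t - s)"]
  show "s \<le> t \<and> (i, j) \<in> level_edges X ^^ nat (t - s) \<Longrightarrow> ((i, s), (j, t)) \<in> level_le X"
    by simp
qed

section \<open>Splitting a chain at its second member\<close>

lemma trans_level_le: "trans (level_le X)"
  by (simp add: level_le_def trans_rtrancl)

lemma level_less_imp_snd_less: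
  assumes "(x, y) \<in> level_le X" "x \<noteq> y"
  shows "snd x < snd y"
  using assms by (cases x; cases y) (auto simp: level_le_iff order_le_less)

text \<open>By transitivity a chain from \<open>x\<close> to \<open>y\<close> stays inside the
  interval. Dropping the interval, which changes with \<open>x\<close>, lets the tail of a chain be
  treated as a chain of the same kind.\<close>

lemma bounded_chains_level_interval:
  "bounded_chains (level_interval X x y) (level_le X) x y = bounded_chains UNIV (level_le X) x y"
proof -
  have "set xs \<subseteq> level_interval X x y"
    if "xs \<in> bounded_chains UNIV (level_le X) x y" for xs
  proof
    fix z assume z: "z \<in> set xs"
    from that have sorted: "sorted_wrt (\<lambda>x y. (x, y) \<in> level_le X \<and> x \<noteq> y) xs"
      and ends: "hd xs = x" "last xs = y"
      by (auto simp: bounded_chains_def)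
    from z obtain us vs where xs: "xs = us @ z # vs" by (meson split_list)
    have "(x, z) \<in> level_le X"
      using sorted ends(1) unfolding xs by (cases us) (auto simp: sorted_wrt_append level_le_def)
    moreover have "(z, y) \<in> level_le X"
      using sorted ends(2) unfolding xs
      by (cases vs rule: rev_cases) (auto simp: sorted_wrt_append level_le_def)
    ultimately show "z \<in> level_interval X x y" by (simp add: level_interval_def)
  qed
  then show ?thesis by (auto simp: bounded_chains_def)
qed

text \<open>Transitivity and antisymmetry carry the strict inequality between \<open>x\<close> and
  \<open>z\<close> over to all later members, so only the first step has to be checked.\<close>

lemma Cons_mem_bounded_chains:
  assumes "trans R" "antisym R" "zs \<in> bounded_chains UNIV R z y"
  shows "x # zs \<in> bounded_chains UNIV R x y \<longleftrightarrow> (x, z) \<in> R \<and> x \<noteq> z"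
proof -
  obtain z' vs where zs: "zs = z # z' # vs"
    using assms(3) by (cases zs; cases "tl zs") (auto simp: bounded_chains_def)
  have "(x, v) \<in> R \<and> x \<noteq> v" if "(x, z) \<in> R" "x \<noteq> z" "(z, v) \<in> R" for v
    using that assms(1,2) by (metis antisymD transD)
  then show ?thesis using assms(3) unfolding zs bounded_chains_def by auto
qed

lemma antisym_level_le: "antisym (level_le X)"
  by (rule antisymI) (metis level_less_imp_snd_less less_asym)

text \<open>A chain is either the pair of its ends or has a second member \<open>z\<close> other
  than \<open>y\<close>, from which its tail is again a chain. The condition on \<open>snd z\<close>
  bounds the levels available to \<open>z\<close>.\<close>

lemma bounded_chains_level_rec:
  "bounded_chains UNIV (level_le X) x y =
     (if (x, y) \<in> level_le X \<and> x \<noteq> y then {[x, y]} else {})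
     \<union> (\<Union>z\<in>{z. (x, z) \<in> level_le X \<and> x \<noteq> z \<and> snd z < snd y}.
          Cons x ` bounded_chains UNIV (level_le X) z y)" (is "?C x = ?A \<union> ?B")
proof (intro equalityI subsetI)
  fix xs assume xs: "xs \<in> ?C x"
  then obtain z zs where eq: "xs = x # z # zs"
    by (cases xs; cases "tl xs") (auto simp: bounded_chains_def)
  show "xs \<in> ?A \<union> ?B"
  proof (cases zs)
    case Nil
    with xs eq show ?thesis by (auto simp: bounded_chains_def)
  next
    case (Cons v vs)
    with xs eq have tl: "z # zs \<in> ?C z" by (auto simp: bounded_chains_def)
    have "y \<in> set zs" using xs eq Cons by (auto simp: bounded_chains_def)
    with tl have "(z, y) \<in> level_le X" "z \<noteq> y"
      by (simp_all add: bounded_chains_def)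
    then have "snd z < snd y" by (rule level_less_imp_snd_less)
    moreover have "(x, z) \<in> level_le X" "x \<noteq> z"
      using xs eq by (simp_all add: bounded_chains_def)
    ultimately have "z \<in> {z. (x, z) \<in> level_le X \<and> x \<noteq> z \<and> snd z < snd y}" by simp
    then have "xs \<in> ?B" using tl unfolding eq by blast
    then show ?thesis ..
  qed
next
  fix xs assume "xs \<in> ?A \<union> ?B"
  then show "xs \<in> ?C x"
  proof
    assume "xs \<in> ?A"
    then show ?thesis by (auto simp: bounded_chains_def split: if_splits)
  next
    assume "xs \<in> ?B"
    then show ?thesis
      using Cons_mem_bounded_chains[OF trans_level_le antisym_level_le] by blast
  qed
qed

lemma bounded_chains_imp_le:
  "xs \<in> bounded_chains UNIV (level_le X) x y \<Longrightarrow> (x, y) \<in> level_le X"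
  unfolding bounded_chains_level_interval[symmetric]
  by (cases xs) (auto simp: bounded_chains_def level_interval_def)

lemma bounded_chains_hd:
  "xs \<in> bounded_chains P R x y \<Longrightarrow> \<exists>v vs. xs = x # v # vs"
  by (cases xs; cases "tl xs") (auto simp: bounded_chains_def)

text \<open>The entry of index \<open>k\<close> belongs to intervals of rank \<open>k + 1\<close>, whose ab-index has degree \<open>k\<close>.\<close>

fun interval_index :: "int mat \<Rightarrow> nat \<Rightarrow> nat \<Rightarrow> nat \<Rightarrow> ab_series" where
  "interval_index X k i j =
     of_bool ((i, j) \<in> level_edges X ^^ Suc k) * (avar - bvar) ^ k
     + (\<Sum>s<k. \<Sum>l<dim_col X. of_bool ((i, l) \<in> level_edges X ^^ Suc s)
          * (avar - bvar) ^ s * bvar * interval_index X (k - Suc s) l j)"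

declare interval_index.simps [simp del]

text \<open>Induction on the rank, with the starting level arbitrary because the tail of a chain
  starts higher. Finiteness is carried along since the sum is split over unions of finite
  sets.\<close>

lemma sum_chain_weight:
  "finite (bounded_chains UNIV (level_le X) (i, s) (j, s + int (Suc k))) \<and>
   (\<Sum>xs\<in>bounded_chains UNIV (level_le X) (i, s) (j, s + int (Suc k)). chain_weight snd xs)
     = interval_index X k i j"
proof (induction k arbitrary: i s rule: less_induct)
  case (less k)
  define C where "C x = bounded_chains UNIV (level_le X) x (j, s + int (Suc k))" for x
  \<comment> \<open>A second member of a chain is encoded by \<open>m\<close>, its height above
    \<open>(i, s)\<close> minus one, and its index \<open>l\<close>; \<open>z\<close> converts the
    pair back to an element of the poset.\<close>
  define Z where "Z = (SIGMA m:{..<k}. {l. l < dim_col X \<and> (i, l) \<in> level_edges X ^^ Suc m})"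
  define z where "z = (\<lambda>(m :: nat, l :: nat). (l, s + int (Suc m)))"
  define A where "A = (if (i, j) \<in> level_edges X ^^ Suc k
    then {[(i, s), (j, s + int (Suc k))]} else {})"
  have IH: "finite (C (z p)) \<and> sum (chain_weight snd) (C (z p)) = interval_index X (k - Suc (fst p)) (snd p) j"
    if "p \<in> Z" for p
  proof -
    obtain m l where p: "p = (m, l)" "m < k"
      using \<open>p \<in> Z\<close> by (cases p) (auto simp: Z_def)
    \<comment> \<open>The fixed upper level is written relative to the start of the tail, as the
      induction hypothesis requires.\<close>
    have "s + int (Suc k) = (s + int (Suc m)) + int (Suc (k - Suc m))" using p by simp
    then show ?thesis
      using less.IH[of "k - Suc m" l "s + int (Suc m)"] p
      by (simp only: C_def z_def) simp
  qed
  have finZ: "finite Z" by (auto simp: Z_def)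
  have "{v. ((i, s), v) \<in> level_le X \<and> (i, s) \<noteq> v \<and> snd v < s + int (Suc k)} = z ` Z"
  proof (intro equalityI subsetI)
    fix v assume v: "v \<in> {v. ((i, s), v) \<in> level_le X \<and> (i, s) \<noteq> v \<and> snd v < s + int (Suc k)}"
    obtain l t where lt: "v = (l, t)" by (cases v)
    define m where "m = nat (t - s) - 1"
    have "s < t" using v level_less_imp_snd_less[of "(i, s)" v X] by (auto simp: lt)
    with v have m: "m < k" "t = s + int (Suc m)" "(i, l) \<in> level_edges X ^^ Suc m"
      by (auto simp: m_def lt level_le_iff)
    from m(3) have "l < dim_col X" by (auto simp: level_edges_def)
    with m show "v \<in> z ` Z" by (auto simp: z_def Z_def lt image_iff)
  next
    fix v assume "v \<in> z ` Z"
    then show "v \<in> {v. ((i, s), v) \<in> level_le X \<and> (i, s) \<noteq> v \<and> snd v < s + int (Suc k)}"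
      by (auto simp: z_def Z_def level_le_iff nat_add_distrib)
  qed
  moreover have "((i, s), (j, s + int (Suc k))) \<in> level_le X \<longleftrightarrow> (i, j) \<in> level_edges X ^^ Suc k"
    by (simp add: level_le_iff nat_add_distrib del: relpow.simps)
  ultimately have C: "C (i, s) = A \<union> (\<Union>p\<in>Z. Cons (i, s) ` C (z p))"
    unfolding C_def A_def by (subst bounded_chains_level_rec) simp
  have hd: "\<exists>v vs. xs = z p # v # vs" if "xs \<in> C (z p)" for xs p
    using bounded_chains_hd that by (fastforce simp: C_def)
  have finU: "finite (\<Union>p\<in>Z. Cons (i, s) ` C (z p))" using finZ IH by blast
  \<comment> \<open>The head of the tail determines \<open>p\<close>, so different second members
    give disjoint families of chains.\<close>
  have "inj z" by (auto simp: inj_def z_def)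
  then have disj: "Cons (i, s) ` C (z p) \<inter> Cons (i, s) ` C (z p') = {}" if "p \<noteq> p'" for p p'
    using that by (auto dest!: hd dest: injD)
  \<comment> \<open>A tail has at least two members, hence these chains have at least three and
    differ from the pair in \<open>A\<close>.\<close>
  have lengths: "length xs \<noteq> 2" if "xs \<in> (\<Union>p\<in>Z. Cons (i, s) ` C (z p))" for xs
    using that by (auto dest!: hd)
  have "sum (chain_weight snd) (C (i, s))
      = sum (chain_weight snd) A + sum (chain_weight snd) (\<Union>p\<in>Z. Cons (i, s) ` C (z p))"
    unfolding C
  proof (intro sum.union_disjoint finU)
    show "finite A" by (simp add: A_def)
    have "length xs = 2" if "xs \<in> A" for xs
      using that by (auto simp: A_def split: if_splits)
    then show "A \<inter> (\<Union>p\<in>Z. Cons (i, s) ` C (z p)) = {}"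
      using lengths by blast
  qed
  also have "sum (chain_weight snd) A = of_bool ((i, j) \<in> level_edges X ^^ Suc k) * (avar - bvar) ^ k"
    by (simp add: A_def del: relpow.simps)
  also have "sum (chain_weight snd) (\<Union>p\<in>Z. Cons (i, s) ` C (z p))
      = (\<Sum>p\<in>Z. sum (chain_weight snd) (Cons (i, s) ` C (z p)))"
    using finZ IH disj by (intro sum.UNION_disjoint) auto
  also have "\<dots> = (\<Sum>p\<in>Z. (avar - bvar) ^ fst p * bvar * interval_index X (k - Suc (fst p)) (snd p) j)"
  proof (intro sum.cong refl)
    fix p assume p: "p \<in> Z"
    have "chain_weight snd ((i, s) # xs) = (avar - bvar) ^ fst p * bvar * chain_weight snd xs"
      if xs: "xs \<in> C (z p)" for xs
    proof -
      obtain v vs where "xs = z p # v # vs" using hd[OF xs] by blast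
      then show ?thesis by (simp add: z_def case_prod_unfold)
    qed
    then have "sum (chain_weight snd) (Cons (i, s) ` C (z p))
        = (\<Sum>xs\<in>C (z p). (avar - bvar) ^ fst p * bvar * chain_weight snd xs)"
      by (subst sum.reindex) simp_all
    then show "sum (chain_weight snd) (Cons (i, s) ` C (z p))
        = (avar - bvar) ^ fst p * bvar * interval_index X (k - Suc (fst p)) (snd p) j"
      using IH[OF p] by (simp add: sum_distrib_left[symmetric])
  qed
  also have "\<dots> = (\<Sum>m<k. \<Sum>l | l < dim_col X \<and> (i, l) \<in> level_edges X ^^ Suc m.
      (avar - bvar) ^ m * bvar * interval_index X (k - Suc m) l j)"
    unfolding Z_def by (subst sum.Sigma) (auto simp: case_prod_unfold)
  also have "\<dots> = (\<Sum>m<k. \<Sum>l<dim_col X. of_bool ((i, l) \<in> level_edges X ^^ Suc m)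
          * (avar - bvar) ^ m * bvar * interval_index X (k - Suc m) l j)"
    by (intro sum.cong refl sum.mono_neutral_cong_left) (auto simp del: relpow.simps)
  finally have "sum (chain_weight snd) (C (i, s)) = interval_index X k i j"
    by (simp add: interval_index.simps[of X k])
  moreover have "finite (C (i, s))" unfolding C using finU by (simp add: A_def)
  ultimately show ?case by (simp only: C_def)
qed

lemma ab_index_level_interval:
  "ab_index (level_interval X (i, 0) (j, int (Suc k))) (level_le X) snd (i, 0) (j, int (Suc k))
     = interval_index X k i j"
  using sum_chain_weight[of X i 0 j k]
  by (simp add: ab_index_def bounded_chains_level_interval del: of_nat_Suc)

section \<open>Degrees of the ab-indices and the series of a level poset\<close>

lemma homogeneous_avar_minus_bvar: "homogeneous 1 (avar - bvar)"
  by (intro homogeneous_diff homogeneous_avar homogeneous_bvar)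

lemma homogeneous_of_bool: "homogeneous 0 (of_bool P)"
  by (cases P) (simp_all add: homogeneous_one)

lemma homogeneous_walk_term: "homogeneous k (of_bool P * (avar - bvar) ^ k)"
  by (rule homogeneous_mult[OF homogeneous_of_bool homogeneous_power[OF homogeneous_avar_minus_bvar]])
    simp

lemma homogeneous_interval_index: "homogeneous k (interval_index X k i j)"
proof (induction k arbitrary: i rule: less_induct)
  case (less k)
  show ?case
    unfolding interval_index.simps[of X k]
  proof (intro homogeneous_add homogeneous_walk_term homogeneous_sum)
    fix s l assume "s \<in> {..<k}"
    then have s: "s < k" by simp
    show "homogeneous k (of_bool ((i, l) \<in> level_edges X ^^ Suc s) * (avar - bvar) ^ s * bvar
        * interval_index X (k - Suc s) l j)"
      by (rule homogeneous_mult[OF homogeneous_mult[OF homogeneous_walk_term homogeneous_bvar refl]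
            less.IH]) (use s in auto)
  qed
qed

lemma locally_finite_homogeneous: "(\<And>k. homogeneous k (f k)) \<Longrightarrow> locally_finite f"
  by (intro locally_finiteI homogeneous_imp_vanishes_below)

text \<open>The summation index is shifted by one, from the rank of an interval to the degree of its
  ab-index; the term for rank 0 is 0 by definition.\<close>

lemma level_series_eq_formal_sum: "level_series X i j = formal_sum (\<lambda>k. interval_index X k i j)"
proof -
  let ?P = "\<lambda>k. 1 \<le> k \<and> ((i, 0), (j, int k)) \<in> level_le X"
  define F where "F k = (if ?P k
     then ab_index (level_interval X (i, 0) (j, int k)) (level_le X) snd (i, 0) (j, int k)
     else 0)" for k
  have F: "F (Suc k) = interval_index X k i j" for k
  proof (cases "?P (Suc k)")
    case True
    then show ?thesis unfolding F_def by (simp only: simp_thms if_True ab_index_level_interval)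
  next
    \<comment> \<open>Between incomparable elements there are no chains, so the recursion yields the
      default value 0 as well.\<close>
    case False
    then have "bounded_chains UNIV (level_le X) (i, 0) (j, int (Suc k)) = {}"
      using bounded_chains_imp_le[of _ X "(i, 0)" "(j, int (Suc k))"] by auto
    then have "interval_index X k i j = 0"
      using sum_chain_weight[of X i 0 j k] by (simp del: of_nat_Suc)
    with False show ?thesis unfolding F_def by (simp only: simp_thms if_False)
  qed
  have "locally_finite F"
    by (subst locally_finite_Suc_iff[symmetric])
      (simp add: F locally_finite_homogeneous homogeneous_interval_index)
  then have "formal_sum F = F 0 + formal_sum (\<lambda>k. F (Suc k))"
    by (rule formal_sum_Suc)
  also have "F 0 = 0" by (simp add: F_def)
  finally show ?thesis unfolding F unfolding F_def level_series_def by simp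
qed

section \<open>Generating series of walks: the matrix \<open>K\<close> and the linear system for the
  level series\<close>

definition walk_series :: "int mat \<Rightarrow> nat \<Rightarrow> nat \<Rightarrow> ab_series" where
  "walk_series X i j =
     formal_sum (\<lambda>k. of_bool ((i, j) \<in> level_edges X ^^ Suc k) * (avar - bvar) ^ k)"

text \<open>The double sum in the recursion of \<open>interval_index\<close> is a convolution in the
  degree, so summing over all degrees turns it into the matrix product in
  \<open>\<Psi> = K + K b \<Psi>\<close>.\<close>

lemma level_series_rec:
  "level_series X i j =
     walk_series X i j + (\<Sum>l<dim_col X. walk_series X i l * bvar * level_series X l j)"
proof -
  define \<kappa> where "\<kappa> l k = of_bool ((i, l) \<in> level_edges X ^^ Suc k) * (avar - bvar) ^ k" for l k
  \<comment> \<open>The letter \<open>b\<close> shifts the degree by one. The value 0 in degree 0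
    lets the convolution run up to \<open>s = k\<close>, as the Cauchy product requires.\<close>
  define g where "g l k = (case k of 0 \<Rightarrow> 0 | Suc m \<Rightarrow> bvar * interval_index X m l j)" for l k
  have \<kappa>: "homogeneous k (\<kappa> l k)" for l k
    unfolding \<kappa>_def by (rule homogeneous_walk_term)
  have g: "homogeneous k (g l k)" for l k
    by (auto simp: g_def split: nat.split
        intro!: homogeneous_mult[OF homogeneous_bvar homogeneous_interval_index])
  have \<kappa>g: "homogeneous k (\<Sum>s\<le>k. \<kappa> l s * g l (k - s))" for l k
    by (intro homogeneous_sum homogeneous_mult[OF \<kappa> g]) auto
  have "formal_sum (g l) = bvar * level_series X l j" for l
  proof -
    have "formal_sum (g l) = g l 0 + formal_sum (\<lambda>m. g l (Suc m))"
      by (rule formal_sum_Suc, rule locally_finite_homogeneous, rule g)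
    also have "\<dots> = formal_sum (\<lambda>m. bvar * interval_index X m l j)" by (simp add: g_def)
    also have "\<dots> = bvar * level_series X l j"
      unfolding level_series_eq_formal_sum
      by (rule formal_sum_mult_left, rule locally_finite_homogeneous, rule homogeneous_interval_index)
    finally show ?thesis .
  qed
  moreover have "interval_index X k i j
      = \<kappa> j k + (\<Sum>l<dim_col X. \<Sum>s\<le>k. \<kappa> l s * g l (k - s))" for k
  proof -
    have "(\<Sum>s\<le>k. \<kappa> l s * g l (k - s))
        = (\<Sum>s<k. \<kappa> l s * bvar * interval_index X (k - Suc s) l j)" for l
    proof (rule sum.mono_neutral_cong_right)
      fix s assume "s \<in> {..<k}"
      then have "k - s = Suc (k - Suc s)" by auto
      then show "\<kappa> l s * g l (k - s) = \<kappa> l s * bvar * interval_index X (k - Suc s) l j"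
        by (simp add: g_def mult.assoc)
    qed (auto simp: g_def)
    then show ?thesis
      by (subst interval_index.simps, subst sum.swap) (simp add: \<kappa>_def)
  qed
  moreover have "walk_series X i l = formal_sum (\<kappa> l)" for l
    unfolding walk_series_def
    by (rule arg_cong[where f = formal_sum]) (simp add: \<kappa>_def fun_eq_iff del: relpow.simps)
  ultimately show ?thesis
    unfolding level_series_eq_formal_sum[of X i]
    by (simp add: formal_sum_add formal_sum_sum formal_sum_Cauchy_product \<kappa> g \<kappa>g mult.assoc
        locally_finite_homogeneous homogeneous_sum)
qed

lemma vanishes_below_avar_minus_bvar: "vanishes_below 1 (avar - bvar)"
  by (intro vanishes_below_diff vanishes_below_avar vanishes_below_bvar)

text \<open>An entry of the matrix \<open>M\<close>, from the truth values of the entries of \<open>N\<close> and of its Boolean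
  square.\<close>

definition step_coeff :: "bool \<Rightarrow> bool \<Rightarrow> ab_series" where
  "step_coeff p q = (let t = avar - bvar in
     (1 - t) * of_bool p + (t - t * t) * of_bool q + t * t)"

text \<open>With all walks of length at least 3 present, the tail of the series is
  \<open>t * t / (1 - t)\<close>, which the factor \<open>1 - t\<close> makes polynomial. Only walks
  of length 1 and 2 still have to be known.\<close>

lemma one_minus_mult_walk_series:
  assumes full: "\<And>k. 2 \<le> k \<Longrightarrow> (i, j) \<in> level_edges X ^^ Suc k"
  shows "(1 - (avar - bvar)) * walk_series X i j
    = step_coeff ((i, j) \<in> level_edges X) ((i, j) \<in> level_edges X ^^ 2)"
proof -
  define t where "t = avar - bvar"
  have t: "vanishes_below 1 t"
    unfolding t_def by (rule vanishes_below_avar_minus_bvar)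
  define f where "f k = of_bool ((i, j) \<in> level_edges X ^^ Suc k) * t ^ k" for k
  have lf1: "locally_finite f"
    unfolding f_def t_def by (intro locally_finite_homogeneous homogeneous_walk_term)
  then have lf2: "locally_finite (\<lambda>k. f (Suc k))"
    by (simp add: locally_finite_Suc_iff)
  have "walk_series X i j = formal_sum f"
    unfolding walk_series_def
    by (rule arg_cong[where f = formal_sum]) (simp add: f_def t_def fun_eq_iff del: relpow.simps)
  also have "\<dots> = f 0 + (f 1 + formal_sum (\<lambda>k. f (Suc (Suc k))))"
    using formal_sum_Suc[OF lf1] formal_sum_Suc[OF lf2] by simp
  \<comment> \<open>The exponent \<open>k + 2\<close> belongs to walks of length
    \<open>k + 3\<close>, which exist by \<open>full\<close>.\<close>
  also have "(\<lambda>k. f (Suc (Suc k))) = (\<lambda>k. t * t * t ^ k)"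
    using full by (simp add: f_def mult.assoc fun_eq_iff del: relpow.simps)
  also have "formal_sum \<dots> = t * t * inv_one_minus t"
    unfolding inv_one_minus_def
    by (intro formal_sum_mult_left locally_finiteI vanishes_below_power t)
  finally have "walk_series X i j = f 0 + (f 1 + t * t * inv_one_minus t)" .
  moreover have "(1 - t) * inv_one_minus t = 1"
    using inv_one_minus_unfold[OF t] by (simp add: algebra_simps)
  then have "(1 - t) * (t * t * inv_one_minus t) = t * t"
  proof -
    assume *: "(1 - t) * inv_one_minus t = 1"
    have "(1 - t) * (t * t * inv_one_minus t) = t * t * ((1 - t) * inv_one_minus t)"
      by (simp add: algebra_simps)
    then show ?thesis using * by simp
  qed
  moreover have "f 0 = of_bool ((i, j) \<in> level_edges X)"
    by (simp add: f_def)
  moreover have "f 1 = of_bool ((i, j) \<in> level_edges X ^^ 2) * t"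
    by (simp add: f_def numeral_2_eq_2)
  ultimately have "(1 - t) * walk_series X i j
      = (1 - t) * of_bool ((i, j) \<in> level_edges X)
        + (t - t * t) * of_bool ((i, j) \<in> level_edges X ^^ 2) + t * t"
    by (simp add: algebra_simps)
  then show ?thesis by (simp add: step_coeff_def Let_def t_def)
qed

text \<open>Multiplying the recursion by \<open>1 - t\<close> replaces \<open>K\<close> by the
  explicit \<open>M\<close>. Column \<open>j\<close> of the level series and the candidate
  \<open>Y\<close> then solve the same system, whose solution is unique.\<close>

lemma level_series_eqI:
  fixes X :: "int mat" and m :: "nat \<Rightarrow> nat \<Rightarrow> ab_series"
  defines "m \<equiv> \<lambda>i l. step_coeff ((i, l) \<in> level_edges X) ((i, l) \<in> level_edges X ^^ 2)"
  assumes full: "\<And>k i l. 2 \<le> k \<Longrightarrow> i < n \<Longrightarrow> l < n \<Longrightarrow> (i, l) \<in> level_edges X ^^ Suc k"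
    and n: "n = dim_col X"
    and Y: "\<And>i. i < n \<Longrightarrow>
      (1 - (avar - bvar)) * Y i = (\<Sum>l<n. m i l * (of_bool (l = j) + bvar * Y l))"
    and "i < n" "j < n"
  shows "level_series X i j = Y i"
proof -
  define t where "t = avar - bvar"
  \<comment> \<open>The term \<open>t * Z i\<close> is moved to the right, which gives a fixpoint
    equation whose coefficients have no constant term.\<close>
  have fixpoint: "Z i = m i j + (\<Sum>l<n. (of_bool (l = i) * t + m i l * bvar) * Z l)"
    if "(1 - t) * Z i = m i j + (\<Sum>l<n. m i l * bvar * Z l)" "i < n" for Z i
  proof -
    have "(\<Sum>l<n. (of_bool (l = i) * t + m i l * bvar) * Z l)
        = (\<Sum>l<n. if l = i then t * Z l else 0) + (\<Sum>l<n. m i l * bvar * Z l)"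
      unfolding sum.distrib[symmetric] by (intro sum.cong) (auto simp: distrib_right)
    also have "(\<Sum>l<n. if l = i then t * Z l else 0) = t * Z i"
      using \<open>i < n\<close> by (simp add: sum.delta)
    finally have "m i j + (\<Sum>l<n. (of_bool (l = i) * t + m i l * bvar) * Z l)
        = t * Z i + (m i j + (\<Sum>l<n. m i l * bvar * Z l))" by (simp add: algebra_simps)
    also have "\<dots> = t * Z i + (1 - t) * Z i" by (simp only: that(1))
    finally show ?thesis by (simp add: algebra_simps)
  qed
  have "(1 - t) * level_series X i j = m i j + (\<Sum>l<n. m i l * bvar * level_series X l j)"
    if "i < n" for i
  proof -
    have w: "(1 - t) * walk_series X i l = m i l" if "l < n" for l
      unfolding m_def t_def
      by (rule one_minus_mult_walk_series) (use full \<open>i < n\<close> that in blast)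
    have "(1 - t) * level_series X i j = (1 - t) * walk_series X i j
        + (\<Sum>l<n. (1 - t) * walk_series X i l * bvar * level_series X l j)"
      by (subst level_series_rec) (simp add: distrib_left sum_distrib_left mult.assoc n)
    then show ?thesis using \<open>j < n\<close> by (simp add: w)
  qed
  then have L: "level_series X i j
      = m i j + (\<Sum>l<n. (of_bool (l = i) * t + m i l * bvar) * level_series X l j)"
    if "i < n" for i using that by (intro fixpoint) auto
  have "(\<Sum>l<n. m i l * (of_bool (l = j) + bvar * Y l)) = m i j + (\<Sum>l<n. m i l * bvar * Y l)" for i
  proof -
    have "(\<Sum>l<n. m i l * (of_bool (l = j) + bvar * Y l))
        = (\<Sum>l<n. if l = j then m i l else 0) + (\<Sum>l<n. m i l * bvar * Y l)"
      unfolding sum.distrib[symmetric] by (intro sum.cong) (auto simp: distrib_left mult.assoc)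
    then show ?thesis using \<open>j < n\<close> by (simp add: sum.delta)
  qed
  then have Y': "Y i = m i j + (\<Sum>l<n. (of_bool (l = i) * t + m i l * bvar) * Y l)"
    if "i < n" for i using that Y[OF that] by (intro fixpoint) (auto simp: t_def)
  have "vanishes_below 1 (of_bool (l = i) * t + m i l * bvar)" for i l
    unfolding t_def by (intro vanishes_below_add vanishes_below_mult_left
        vanishes_below_avar_minus_bvar vanishes_below_bvar)
  from linear_system_unique[OF this L Y' \<open>i < n\<close>] show ?thesis .
qed

subsection \<open>The matrix \<open>N\<close>\<close>

text \<open>The columns of the ones in row \<open>i\<close> of \<open>N\<close>: indices up to
  \<open>r\<close> come from the left blocks, larger ones from the right blocks.\<close>

definition successors :: "nat \<Rightarrow> nat \<Rightarrow> nat set" where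
  "successors r i =
     (if i = 0 then insert (r + 1) {..<r}
      else if i = 1 then {r, r + 1, r + 2}
      else if i \<le> r then {r + i, r + i + 1}
      else if i = r + 1 then insert (2 * r) {..r}
      else insert (2 * r + 1) {..r})"

text \<open>The rows of the Boolean square of \<open>N\<close>; those of the lower half are already
  full.\<close>

definition second_successors :: "nat \<Rightarrow> nat \<Rightarrow> nat set" where
  "second_successors r i =
     (if i = 0 then {..2 * r}
      else if i = 1 then {..r} \<union> {2 * r, 2 * r + 1}
      else if i \<le> r then insert (2 * r + 1) {..r}
      else {..<2 * r + 2})"

lemma level_edges_block_N:
  assumes "2 \<le> r"
  shows "(i, j) \<in> level_edges (block_N r) \<longleftrightarrow> i < 2 * r + 2 \<and> j \<in> successors r i"
  using assms
  by (auto simp: level_edges_def block_N_def block_A_def block_A_dagger_def block_B_def block_J_def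
      successors_def split: if_splits)

text \<open>One chosen row of the upper half with a one in column \<open>j\<close>: in
  \<open>A'\<close> for \<open>j \<le> r\<close>, on the diagonal of \<open>B\<close>
  otherwise.\<close>

definition predecessor :: "nat \<Rightarrow> nat \<Rightarrow> nat" where
  "predecessor r j = (if j < r then 0 else if j = r then 1 else j - (r + 1))"

lemma predecessor:
  assumes "2 \<le> r" "j < 2 * r + 2"
  shows "predecessor r j \<le> r" "j \<in> successors r (predecessor r j)"
  using assms by (auto simp: predecessor_def successors_def)

lemma level_edges_block_N_2:
  assumes r: "2 \<le> r"
  shows "(i, j) \<in> level_edges (block_N r) ^^ 2 \<longleftrightarrow> i < 2 * r + 2 \<and> j \<in> second_successors r i"
proof -
  have "(i, j) \<in> level_edges (block_N r) ^^ 2 \<longleftrightarrow>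
      i < 2 * r + 2 \<and> (\<exists>l. l < 2 * r + 2 \<and> l \<in> successors r i \<and> j \<in> successors r l)"
    by (auto simp: numeral_2_eq_2 level_edges_block_N[OF r])
  moreover have "j \<in> second_successors r i"
    if "i < 2 * r + 2" "l < 2 * r + 2" "l \<in> successors r i" "j \<in> successors r l" for l
    using r that by (auto simp: successors_def second_successors_def split: if_splits)
  moreover have "\<exists>l. l < 2 * r + 2 \<and> l \<in> successors r i \<and> j \<in> successors r l"
    if i: "i < 2 * r + 2" and j: "j \<in> second_successors r i"
  proof -
    \<comment> \<open>The midpoint of a walk of length 2. Row 0 and the lower rows reach the chosen
      predecessor of \<open>j\<close> directly; the other rows pass through a lower row, whose ones
      include all columns up to \<open>r\<close>.\<close>
    define l where "l = (if i = 0 \<or> r < i then predecessor r j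
      else if i = 1 then (if j = 2 * r + 1 then r + 2 else r + 1) else r + i)"
    have "l < 2 * r + 2" "l \<in> successors r i" "j \<in> successors r l"
      using r i j
      by (auto simp: l_def predecessor_def successors_def second_successors_def split: if_splits)
    then show ?thesis by blast
  qed
  ultimately show ?thesis by blast
qed

text \<open>Two steps lead from any \<open>i\<close> to each of \<open>0, ..., r\<close>, which
  include a predecessor of every \<open>j\<close>. So three steps lead everywhere, and each further
  step preserves this.\<close>

lemma relpow_level_edges_block_N:
  assumes r: "2 \<le> r" and k: "2 \<le> k" and i: "i < 2 * r + 2" and j: "j < 2 * r + 2"
  shows "(i, j) \<in> level_edges (block_N r) ^^ Suc k"
  using k j
proof (induction k arbitrary: j rule: dec_induct)
  case base
  have "(i, predecessor r j) \<in> level_edges (block_N r) ^^ 2"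
    using r i predecessor(1)[OF r base]
    by (auto simp: level_edges_block_N_2[OF r] second_successors_def)
  moreover have "(predecessor r j, j) \<in> level_edges (block_N r)"
    using predecessor[OF r base] by (simp add: level_edges_block_N[OF r])
  ultimately show ?case by (subst relpow.simps(2)) blast
next
  case (step k)
  have "(i, predecessor r j) \<in> level_edges (block_N r) ^^ Suc k"
    using predecessor(1)[OF r step.prems] by (intro step.IH) simp
  moreover have "(predecessor r j, j) \<in> level_edges (block_N r)"
    using predecessor[OF r step.prems] by (simp add: level_edges_block_N[OF r])
  ultimately show ?case by (subst relpow.simps(2)) blast
qed

text \<open>The sum of the entries of \<open>M\<close> in row \<open>i\<close> and the columns in \<open>W\<close>. Every column to which \<open>M\<close>
  is applied below is a combination of indicator vectors, so these sums determine the product.\<close>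

definition row_weight :: "nat \<Rightarrow> nat \<Rightarrow> nat set \<Rightarrow> ab_series" where
  "row_weight r i W = (let t = avar - bvar in
     (1 - t) * of_nat (card (successors r i \<inter> W))
     + (t - t * t) * of_nat (card (second_successors r i \<inter> W)) + t * t * of_nat (card W))"

text \<open>Entry \<open>i\<close> of the product of \<open>M\<close> with the column
  \<open>v\<close>; the entries of \<open>M\<close> stand on the left because the series do not
  commute.\<close>

definition row_sum :: "nat \<Rightarrow> nat \<Rightarrow> (nat \<Rightarrow> ab_series) \<Rightarrow> ab_series" where
  "row_sum r i v = (\<Sum>l<2 * r + 2.
     step_coeff (l \<in> successors r i) (l \<in> second_successors r i) * v l)"

lemma row_sum_add: "row_sum r i (\<lambda>l. f l + g l) = row_sum r i f + row_sum r i g"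
  by (simp only: row_sum_def distrib_left sum.distrib)

lemma row_sum_mult_right: "row_sum r i (\<lambda>l. f l * x) = row_sum r i f * x"
  by (simp only: row_sum_def sum_distrib_right mult.assoc)

text \<open>On an indicator column the truth values in \<open>M\<close> add up to cardinalities, and
  a common right factor can be pulled out.\<close>

lemma row_sum_of_bool:
  assumes "W \<subseteq> {..<2 * r + 2}"
  shows "row_sum r i (\<lambda>l. of_bool (l \<in> W) * x) = row_weight r i W * x"
proof -
  have fin: "finite W" using assms finite_subset by blast
  have "row_sum r i (\<lambda>l. of_bool (l \<in> W)) =
      (\<Sum>l\<in>W. step_coeff (l \<in> successors r i) (l \<in> second_successors r i))"
    unfolding row_sum_def using assms by (intro sum.mono_neutral_cong_right) auto
  also have "\<dots> = row_weight r i W"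
    using fin
    by (simp add: step_coeff_def row_weight_def Let_def sum.distrib sum_distrib_left[symmetric]
        sum_of_bool_eq Int_commute mult_of_nat_commute)
  finally show ?thesis by (simp add: row_sum_mult_right)
qed

section \<open>Entries of the vectors and of \<open>D\<close>\<close>

definition q_entry :: "nat \<Rightarrow> nat \<Rightarrow> ab_series" where
  "q_entry r k = (if k = 0 then cvar + of_nat (r - 1) * dvar
     else if k = 1 then cvar + dvar else if k \<le> r then cvar else 1)"

text \<open>Each column of \<open>D\<close> is written as a combination of indicators of sets of
  rows, the form to which \<open>row_sum_of_bool\<close> applies.\<close>

definition D_entry :: "nat \<Rightarrow> nat \<Rightarrow> nat \<Rightarrow> ab_series" where
  "D_entry r k j =
     (if j < r then of_bool (k \<in> {0})
      else if j = r then of_bool (k \<in> {1})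
      else if j < 2 * r then
        of_bool (k \<in> {j - (r + 1)}) + of_bool (k \<in> {j - r}) + of_bool (k \<in> {0}) * cvar
      else if j = 2 * r then
        of_bool (k \<in> {r - 1}) + of_bool (k \<in> {r}) + of_bool (k \<in> {r + 1})
        + of_bool (k \<in> {0}) * cvar + of_bool (k \<in> {1}) * cvar + of_bool (k \<in> {0}) * dvar
      else
        of_bool (k \<in> {r}) + of_bool (k \<in> {r + 2..<2 * r + 2}) + of_bool (k \<in> {1..r}) * cvar
        + of_bool (k \<in> {0}) * (of_nat (r - 2) * dvar) + of_bool (k \<in> {1}) * dvar)"

lemma q_col_index: "1 \<le> r \<Longrightarrow> i < 2 * r + 2 \<Longrightarrow> q_col r $$ (i, 0) = q_entry r i"
  by (auto simp: q_col_def q_entry_def mat_of_cols_def vec_of_list_index nth_append nth_Cons'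
      simp del: vec_of_list_Cons)

text \<open>The row vector is the column vector read backwards, so a single entry function serves
  both.\<close>

lemma q_row_index: "1 \<le> r \<Longrightarrow> j < 2 * r + 2 \<Longrightarrow> q_row r $$ (0, j) = q_entry r (2 * r + 1 - j)"
  by (auto simp: q_row_def q_entry_def mat_of_rows_def vec_of_list_index nth_append nth_Cons'
      simp del: vec_of_list_Cons)

lemma D_mat_index:
  assumes "2 \<le> r" "i < 2 * r + 2" "j < 2 * r + 2"
  shows "D_mat r $$ (i, j) = D_entry r i j"
proof -
  \<comment> \<open>\<open>block_G\<close> subtracts in the integers, \<open>D_entry\<close> in the
    natural numbers; the two agree for \<open>2 \<le> r\<close>.\<close>
  have [simp]: "of_int (int r - 2) = (of_nat (r - 2) :: ab_series)"
    using assms(1) by (metis of_int_of_nat_eq of_nat_diff of_nat_numeral)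
  have blocks: "D_mat r $$ (i, j) =
     (if i \<le> r then
        if j \<le> r then of_int (block_A r $$ (i, j))
        else of_int (block_B r $$ (i, j - (r + 1))) + of_int (block_F r $$ (i, j - (r + 1))) * cvar
          + of_int (block_G r $$ (i, j - (r + 1))) * dvar
      else if j \<le> r then 0
      else of_int (block_A_dagger r $$ (i - (r + 1), j - (r + 1))))"
  proof -
    have dims: "dim_row (block_A r) = r + 1" "dim_col (block_A r) = r + 1"
      "dim_row (block_A_dagger r) = r + 1" "dim_col (block_A_dagger r) = r + 1"
      by (simp_all add: block_A_def block_A_dagger_def)
    show ?thesis
      using assms(2,3)
      by (simp add: D_mat_def Let_def series_mat_def mat_times_def dims)
  qed
  note defs = block_A_def block_A_dagger_def block_B_def block_F_def block_G_def D_entry_def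
  consider "j < r" | "j = r" | p where "j = r + 1 + p" "p < r - 1" | "j = 2 * r" | "j = 2 * r + 1"
  proof -
    assume *: "j < r \<Longrightarrow> thesis" "j = r \<Longrightarrow> thesis"
      "\<And>p. j = r + 1 + p \<Longrightarrow> p < r - 1 \<Longrightarrow> thesis"
      "j = 2 * r \<Longrightarrow> thesis" "j = 2 * r + 1 \<Longrightarrow> thesis"
    show thesis
      using *(1,2,4,5) *(3)[of "j - (r + 1)"] assms by linarith
  qed
  then show ?thesis
  proof cases
    case 1
    then show ?thesis unfolding blocks using assms by (auto simp: defs)
  next
    case 2
    then show ?thesis unfolding blocks using assms by (auto simp: defs)
  next
    case 3
    then show ?thesis unfolding blocks using assms by (cases "i \<le> r") (auto simp: defs)
  next
    case 4
    moreover have "j - (r + 1) = r - 1" using 4 by simp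
    ultimately show ?thesis unfolding blocks using assms by (cases "i \<le> r") (auto simp: defs)
  next
    case 5
    moreover have "j - (r + 1) = r" using 5 by simp
    ultimately show ?thesis unfolding blocks using assms by (cases "i \<le> r") (auto simp: defs)
  qed
qed

text \<open>The column \<open>u\<close>.\<close>

definition row_factor :: "nat \<Rightarrow> nat \<Rightarrow> ab_series" where
  "row_factor r i = (if i = 0 then avar else if i \<le> r then (avar - bvar) * (1 + bvar) else 1 + bvar)"

text \<open>Natural numbers are central. These rules move them to the left of the letters, so that
  expansion reaches a normal form.\<close>

lemma of_nat_avar_commute: "avar * of_nat m = of_nat m * avar" "avar * (of_nat m * x) = of_nat m * (avar * x)"
  and of_nat_bvar_commute: "bvar * of_nat m = of_nat m * bvar" "bvar * (of_nat m * x) = of_nat m * (bvar * x)"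
  by (simp_all only: mult_of_nat_commute[of m avar] mult_of_nat_commute[of m bvar] mult.assoc[symmetric])

section \<open>Row weights of single columns and of two ranges of columns\<close>

lemma row_weight_singleton:
  "row_weight r i {a} = step_coeff (a \<in> successors r i) (a \<in> second_successors r i)"
  by (auto simp: row_weight_def step_coeff_def Let_def)

text \<open>These are the two larger sets of rows on which \<open>q\<close> and the last column of
  \<open>D\<close> are constant up to single entries. Both have \<open>r\<close> elements, so the
  all-ones part of \<open>M\<close> contributes \<open>t * t * r\<close> each time.\<close>

lemma row_weight_values:
  assumes "2 \<le> r"
  defines "t \<equiv> avar - bvar"
  shows "row_weight r 0 {1..r} = (1 - t) * (of_nat r - 1) + t * of_nat r"
    and "row_weight r 1 {1..r} = 1 - t + t * of_nat r"
    and "2 \<le> i \<Longrightarrow> i \<le> r \<Longrightarrow> row_weight r i {1..r} = t * of_nat r"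
    and "r < i \<Longrightarrow> row_weight r i {1..r} = of_nat r"
    and "row_weight r 0 {r + 2..<2 * r + 2} = (t - t * t) * (of_nat r - 1) + t * t * of_nat r"
    and "row_weight r 1 {r + 2..<2 * r + 2} = (1 - t) + (t - t * t) + (t - t * t) + t * t * of_nat r"
    and "2 \<le> i \<Longrightarrow> i \<le> r \<Longrightarrow> row_weight r i {r + 2..<2 * r + 2} = (1 - t) + (1 - t) + (t - t * t) + t * t * of_nat r"
    and "r < i \<Longrightarrow> row_weight r i {r + 2..<2 * r + 2} = (1 - t) + t * of_nat r"
proof -
  let ?U = "{1..r}" and ?V = "{r + 2..<2 * r + 2}"
  have card: "card ?U = r" "card ?V = r" by simp_all
  have *: "row_weight r i W = (1 - t) * of_nat k + (t - t * t) * of_nat l + t * t * of_nat r"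
    if "card W = r" "successors r i \<inter> W = K" "second_successors r i \<inter> W = L"
      "card K = k" "card L = l" for i W K L k l
    using that by (simp add: row_weight_def t_def Let_def)
  have r1: "of_nat (r - Suc 0) = (of_nat r - 1 :: ab_series)" using assms by (simp add: of_nat_diff)
  have "successors r 0 \<inter> ?U = {1..<r}" "second_successors r 0 \<inter> ?U = {1..r}"
    using assms by (auto simp: successors_def second_successors_def)
  from *[OF card(1) this refl refl]
  show "row_weight r 0 ?U = (1 - t) * (of_nat r - 1) + t * of_nat r"
    by (simp add: r1 algebra_simps mult_2 mult_2_right)
  have "successors r 1 \<inter> ?U = {r}" "second_successors r 1 \<inter> ?U = {1..r}"
    using assms by (auto simp: successors_def second_successors_def)
  from *[OF card(1) this refl refl]
  show "row_weight r 1 ?U = 1 - t + t * of_nat r"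
    by (simp add: algebra_simps mult_2 mult_2_right)
  have "successors r 0 \<inter> ?V = {}" "second_successors r 0 \<inter> ?V = {r + 2..2 * r}"
    using assms by (auto simp: successors_def second_successors_def)
  from *[OF card(2) this refl refl]
  show "row_weight r 0 ?V = (t - t * t) * (of_nat r - 1) + t * t * of_nat r"
    using assms by (simp add: r1 algebra_simps mult_2 mult_2_right)
  have "successors r 1 \<inter> ?V = {r + 2}" "second_successors r 1 \<inter> ?V = {2 * r, 2 * r + 1}"
    using assms by (auto simp: successors_def second_successors_def)
  from *[OF card(2) this refl refl]
  show "row_weight r 1 ?V = (1 - t) + (t - t * t) + (t - t * t) + t * t * of_nat r"
    by (simp add: algebra_simps mult_2 mult_2_right)
  {
    assume i: "2 \<le> i" "i \<le> r"
    have "successors r i \<inter> ?U = {}" "second_successors r i \<inter> ?U = {1..r}"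
      using assms i by (auto simp: successors_def second_successors_def)
    from *[OF card(1) this refl refl]
    show "row_weight r i ?U = t * of_nat r"
      by (simp add: algebra_simps mult_2 mult_2_right)
    have "successors r i \<inter> ?V = {r + i, r + i + 1}" "second_successors r i \<inter> ?V = {2 * r + 1}"
      using assms i by (auto simp: successors_def second_successors_def)
    from *[OF card(2) this refl refl]
    show "row_weight r i ?V = (1 - t) + (1 - t) + (t - t * t) + t * t * of_nat r"
      by (simp add: algebra_simps mult_2 mult_2_right)
  next
    assume i: "r < i"
    have "successors r i \<inter> ?U = {1..r}" "second_successors r i \<inter> ?U = {1..r}"
      using assms i by (auto simp: successors_def second_successors_def)
    from *[OF card(1) this refl refl]
    show "row_weight r i ?U = of_nat r"
      by (simp add: algebra_simps mult_2 mult_2_right)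
    \<comment> \<open>The two kinds of lower rows meet the range in different columns, but in
      exactly one column each.\<close>
    have "successors r i \<inter> ?V = (if i = r + 1 then {2 * r} else {2 * r + 1})"
      "second_successors r i \<inter> ?V = ?V"
      using assms i by (auto simp: successors_def second_successors_def)
    from *[OF card(2) this refl refl]
    show "row_weight r i ?V = (1 - t) + t * of_nat r"
      by (auto simp: algebra_simps mult_2 mult_2_right split: if_splits)
  }
qed

text \<open>The first identity for \<open>u\<close>. After \<open>b q\<close> is decomposed into
  indicators, each row becomes an identity between polynomials in the non-commuting letters
  \<open>a\<close> and \<open>b\<close>.\<close>

lemma row_sum_q_entry:
  assumes r: "2 \<le> r"
  shows "(1 - (avar - bvar)) * q_entry r i - row_sum r i (\<lambda>k. bvar * q_entry r k)
    = row_factor r i * (1 - (cvar + of_nat r * dvar))"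
proof -
  \<comment> \<open>Writing \<open>r\<close> as \<open>m + 2\<close> removes the truncated
    subtraction in \<open>r - 1\<close> before the expansion.\<close>
  obtain m where m: "r = Suc (Suc m)" using r by (metis add_2_eq_Suc le_Suc_ex)
  \<comment> \<open>The entries 1 are split into index \<open>r + 1\<close> and the range above it,
    since that range also occurs in the last column of \<open>D\<close>.\<close>
  have "row_sum r i (\<lambda>k. bvar * q_entry r k) = row_sum r i (\<lambda>k. of_bool (k \<in> {1..r}) * (bvar * cvar)
      + of_bool (k \<in> {0}) * (bvar * (cvar + of_nat (r - 1) * dvar)) + of_bool (k \<in> {1}) * (bvar * dvar)
      + of_bool (k \<in> {r + 1}) * bvar + of_bool (k \<in> {r + 2..<2 * r + 2}) * bvar)"
    unfolding row_sum_def using r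
    by (intro sum.cong refl arg_cong2[where f = "(*)"]) (auto simp: q_entry_def distrib_left)
  also have "\<dots> = row_weight r i {1..r} * (bvar * cvar)
      + row_weight r i {0} * (bvar * (cvar + of_nat (r - 1) * dvar)) + row_weight r i {1} * (bvar * dvar)
      + row_weight r i {r + 1} * bvar + row_weight r i {r + 2..<2 * r + 2} * bvar"
  proof -
    have "{1..r} \<subseteq> {..<2 * r + 2}" "{r + 2..<2 * r + 2} \<subseteq> {..<2 * r + 2}"
      "{0} \<subseteq> {..<2 * r + 2}" "{1} \<subseteq> {..<2 * r + 2}" "{r + 1} \<subseteq> {..<2 * r + 2}"
      by auto
    then show ?thesis by (simp only: row_sum_add row_sum_of_bool)
  qed
  finally have sum: "row_sum r i (\<lambda>k. bvar * q_entry r k) = \<dots>" .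
  note expand = row_weight_singleton q_entry_def row_factor_def step_coeff_def
    successors_def second_successors_def Let_def
  note ring = cvar_def dvar_def algebra_simps mult_2 mult_2_right of_nat_avar_commute of_nat_bvar_commute
  consider "i = 0" | "i = 1" | "2 \<le> i" "i \<le> r" | "r < i" by linarith
  then show ?thesis
  proof cases
    case 1
    show ?thesis unfolding sum unfolding 1 row_weight_values[OF r]
      using r by (simp add: expand) (simp add: m ring)
  next
    case 2
    show ?thesis unfolding sum unfolding 2 row_weight_values[OF r]
      using r by (simp add: expand) (simp add: m ring)
  next
    case 3
    show ?thesis unfolding sum row_weight_values(3,7)[OF r 3]
      using r 3 by (simp add: expand) (simp add: m ring)
  next
    case 4
    show ?thesis unfolding sum row_weight_values(4,8)[OF r 4]
      using r 4 by (simp add: expand) (simp add: m ring)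
  qed
qed

text \<open>The second identity for \<open>u\<close>, in column \<open>j\<close>. The columns are
  treated by their shape in \<open>D_entry\<close>, the rows by their shape in
  \<open>N\<close>.\<close>

lemma row_sum_D_entry:
  assumes r: "2 \<le> r" and i: "i < 2 * r + 2" and j: "j < 2 * r + 2"
  shows "row_factor r i * q_entry r (2 * r + 1 - j) + (1 - (avar - bvar)) * D_entry r i j
    = row_sum r i (\<lambda>k. of_bool (k = j) + bvar * D_entry r k j)"
proof -
  obtain m where m: "r = Suc (Suc m)" using r by (metis add_2_eq_Suc le_Suc_ex)
  note expand = row_weight_singleton q_entry_def row_factor_def step_coeff_def
    successors_def second_successors_def Let_def
  note expand' = row_factor_def step_coeff_def successors_def second_successors_def Let_def
  note ring = cvar_def dvar_def algebra_simps mult_2 mult_2_right of_nat_avar_commute of_nat_bvar_commute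
  have singleton: "row_sum r i (\<lambda>k. of_bool (k \<in> {a}) * x)
      = step_coeff (a \<in> successors r i) (a \<in> second_successors r i) * x"
    if "a < 2 * r + 2" for a x
    using row_sum_of_bool[of "{a}" r i x] that by (simp only: row_weight_singleton) simp
  \<comment> \<open>A row elimination rule with a free conclusion, so that it can be reused for each
    shape of column.\<close>
  have rows: thesis if "i = 0 \<Longrightarrow> thesis" "i = 1 \<Longrightarrow> thesis" "2 \<le> i \<Longrightarrow> i \<le> r \<Longrightarrow> thesis" "i = r + 1 \<Longrightarrow> thesis"
    "r + 1 < i \<Longrightarrow> thesis" for thesis
    using that by linarith
  consider "j < r" | "j = r" | p where "j = r + 1 + p" "p < r - 1" | "j = 2 * r" | "j = 2 * r + 1"
  proof -
    assume *: "j < r \<Longrightarrow> thesis" "j = r \<Longrightarrow> thesis"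
      "\<And>p. j = r + 1 + p \<Longrightarrow> p < r - 1 \<Longrightarrow> thesis"
      "j = 2 * r \<Longrightarrow> thesis" "j = 2 * r + 1 \<Longrightarrow> thesis"
    show thesis
      using *(1,2,4,5) *(3)[of "j - (r + 1)"] r j by linarith
  qed
  then show ?thesis
  proof cases
    case 1
    have "(\<lambda>k. of_bool (k = j) + bvar * D_entry r k j)
        = (\<lambda>k. of_bool (k \<in> {j}) * 1 + of_bool (k \<in> {0}) * bvar)"
      using 1 by (auto simp: D_entry_def fun_eq_iff)
    then have "row_sum r i (\<lambda>k. of_bool (k = j) + bvar * D_entry r k j)
        = step_coeff (j \<in> successors r i) (j \<in> second_successors r i) * 1
          + step_coeff (0 \<in> successors r i) (0 \<in> second_successors r i) * bvar"
      using j by (simp only: row_sum_add singleton)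
    moreover have "j < r" by fact
    ultimately show ?thesis
      by (rule_tac rows; use r in \<open>auto simp: expand D_entry_def ring\<close>)
  next
    case 2
    have "(\<lambda>k. of_bool (k = j) + bvar * D_entry r k j)
        = (\<lambda>k. of_bool (k \<in> {r}) * 1 + of_bool (k \<in> {1}) * bvar)"
      using 2 by (auto simp: D_entry_def fun_eq_iff)
    then have "row_sum r i (\<lambda>k. of_bool (k = j) + bvar * D_entry r k j)
        = step_coeff (r \<in> successors r i) (r \<in> second_successors r i) * 1
          + step_coeff (1 \<in> successors r i) (1 \<in> second_successors r i) * bvar"
      using r by (simp only: row_sum_add singleton)
    moreover have "j = r" by fact
    ultimately show ?thesis
      by (rule_tac rows; use r in \<open>auto simp: expand D_entry_def ring\<close>)
  next
    case p: 3
    then have p': "p + 1 < r" by simp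
    have "(\<lambda>k. of_bool (k = j) + bvar * D_entry r k j)
        = (\<lambda>k. of_bool (k \<in> {j}) * 1 + of_bool (k \<in> {p}) * bvar + of_bool (k \<in> {p + 1}) * bvar
             + of_bool (k \<in> {0}) * (bvar * cvar))"
      using p by (auto simp: D_entry_def fun_eq_iff distrib_left)
    then have "row_sum r i (\<lambda>k. of_bool (k = j) + bvar * D_entry r k j)
        = step_coeff (j \<in> successors r i) (j \<in> second_successors r i) * 1
          + step_coeff (p \<in> successors r i) (p \<in> second_successors r i) * bvar
          + step_coeff (p + 1 \<in> successors r i) (p + 1 \<in> second_successors r i) * bvar
          + step_coeff (0 \<in> successors r i) (0 \<in> second_successors r i) * (bvar * cvar)"
      using r j p by (simp only: row_sum_add singleton)
    moreover have "q_entry r (2 * r + 1 - j) = cvar"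
      using p by (auto simp: q_entry_def)
    moreover have "D_entry r i j = of_bool (i = p) + of_bool (i = p + 1) + of_bool (i = 0) * cvar"
      using p' p(1) by (auto simp: D_entry_def)
    \<comment> \<open>The case distinctions below decide whether \<open>i\<close> is
      \<open>p\<close> or \<open>p + 1\<close>, the two rows in which column \<open>p\<close> of
      \<open>B\<close> has its ones.\<close>
    moreover have "row_factor r i * cvar + (1 - (avar - bvar)) *
        (of_bool (i = p) + of_bool (i = p + 1) + of_bool (i = 0) * cvar)
      = step_coeff (j \<in> successors r i) (j \<in> second_successors r i) * 1
          + step_coeff (p \<in> successors r i) (p \<in> second_successors r i) * bvar
          + step_coeff (p + 1 \<in> successors r i) (p + 1 \<in> second_successors r i) * bvar
          + step_coeff (0 \<in> successors r i) (0 \<in> second_successors r i) * (bvar * cvar)"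
    proof (rule rows)
      assume "i = 0"
      then show ?thesis
        unfolding p(1) using p' by (cases "p = 0") (simp_all add: expand', simp_all add: ring)
    next
      assume "i = 1"
      then show ?thesis
        unfolding p(1) using p' by (cases "p = 0"; cases "p = 1") (simp_all add: expand', simp_all add: ring)
    next
      assume "2 \<le> i" "i \<le> r"
      then show ?thesis
        unfolding p(1) using p' by (cases "i = p"; cases "i = p + 1") (simp_all add: expand', simp_all add: ring)
    next
      assume "i = r + 1"
      then show ?thesis
        unfolding p(1) using p' by (simp add: expand') (simp add: ring)
    next
      assume "r + 1 < i"
      then show ?thesis
        unfolding p(1) using p' i by (simp add: expand') (simp add: ring)
    qed
    ultimately show ?thesis by (simp only:)
  next
    case 4
    have "(\<lambda>k. of_bool (k = j) + bvar * D_entry r k j)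
        = (\<lambda>k. of_bool (k \<in> {2 * r}) * 1 + of_bool (k \<in> {r - 1}) * bvar + of_bool (k \<in> {r}) * bvar
             + of_bool (k \<in> {r + 1}) * bvar + of_bool (k \<in> {0}) * (bvar * cvar)
             + of_bool (k \<in> {1}) * (bvar * cvar) + of_bool (k \<in> {0}) * (bvar * dvar))"
      using 4 r by (auto simp: D_entry_def fun_eq_iff distrib_left)
    then have "row_sum r i (\<lambda>k. of_bool (k = j) + bvar * D_entry r k j)
        = step_coeff (2 * r \<in> successors r i) (2 * r \<in> second_successors r i) * 1
          + step_coeff (r - 1 \<in> successors r i) (r - 1 \<in> second_successors r i) * bvar
          + step_coeff (r \<in> successors r i) (r \<in> second_successors r i) * bvar
          + step_coeff (r + 1 \<in> successors r i) (r + 1 \<in> second_successors r i) * bvar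
          + step_coeff (0 \<in> successors r i) (0 \<in> second_successors r i) * (bvar * cvar)
          + step_coeff (1 \<in> successors r i) (1 \<in> second_successors r i) * (bvar * cvar)
          + step_coeff (0 \<in> successors r i) (0 \<in> second_successors r i) * (bvar * dvar)"
      using r by (simp only: row_sum_add singleton)
    moreover have "q_entry r (2 * r + 1 - j) = cvar + dvar"
      using 4 by (simp add: q_entry_def)
    moreover have "D_entry r i j = of_bool (i = r - 1) + of_bool (i = r) + of_bool (i = r + 1)
        + of_bool (i = 0) * cvar + of_bool (i = 1) * cvar + of_bool (i = 0) * dvar"
      using 4 r by (simp add: D_entry_def)
    moreover have "row_factor r i * (cvar + dvar) + (1 - (avar - bvar)) *
        (of_bool (i = r - 1) + of_bool (i = r) + of_bool (i = r + 1)
          + of_bool (i = 0) * cvar + of_bool (i = 1) * cvar + of_bool (i = 0) * dvar)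
      = step_coeff (2 * r \<in> successors r i) (2 * r \<in> second_successors r i) * 1
          + step_coeff (r - 1 \<in> successors r i) (r - 1 \<in> second_successors r i) * bvar
          + step_coeff (r \<in> successors r i) (r \<in> second_successors r i) * bvar
          + step_coeff (r + 1 \<in> successors r i) (r + 1 \<in> second_successors r i) * bvar
          + step_coeff (0 \<in> successors r i) (0 \<in> second_successors r i) * (bvar * cvar)
          + step_coeff (1 \<in> successors r i) (1 \<in> second_successors r i) * (bvar * cvar)
          + step_coeff (0 \<in> successors r i) (0 \<in> second_successors r i) * (bvar * dvar)"
    proof (rule rows)
      assume "i = 0"
      then show ?thesis by (simp add: m expand') (simp add: ring)
    next
      \<comment> \<open>For \<open>m = 0\<close>, that is \<open>r = 2\<close>, row 1 is also row
        \<open>r - 1\<close>, and one more indicator becomes true.\<close>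
      assume "i = 1"
      then show ?thesis by (cases "m = 0") (simp_all add: m expand', simp_all add: ring)
    next
      assume "2 \<le> i" "i \<le> r"
      then show ?thesis using r
        by (cases "i = r"; cases "i = r - 1") (simp_all add: m expand', simp_all add: ring)
    next
      assume "i = r + 1"
      then show ?thesis by (simp add: m expand') (simp add: ring)
    next
      assume "r + 1 < i"
      then show ?thesis using i by (simp add: m expand') (simp add: ring)
    qed
    ultimately show ?thesis by (simp only:)
  next
    case 5
    \<comment> \<open>Only the last column involves the two larger ranges, so only here do the
      values of \<open>row_weight_values\<close> enter.\<close>
    have D: "(\<lambda>k. of_bool (k = j) + bvar * D_entry r k j)
        = (\<lambda>k. of_bool (k \<in> {2 * r + 1}) * 1 + of_bool (k \<in> {r}) * bvar
             + of_bool (k \<in> {r + 2..<2 * r + 2}) * bvar + of_bool (k \<in> {1..r}) * (bvar * cvar)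
             + of_bool (k \<in> {0}) * (bvar * (of_nat (r - 2) * dvar)) + of_bool (k \<in> {1}) * (bvar * dvar))"
      using 5 r by (auto simp: D_entry_def fun_eq_iff distrib_left)
    have "{1..r} \<subseteq> {..<2 * r + 2}" "{r + 2..<2 * r + 2} \<subseteq> {..<2 * r + 2}" by auto
    with D r have sum: "row_sum r i (\<lambda>k. of_bool (k = j) + bvar * D_entry r k j)
        = step_coeff (2 * r + 1 \<in> successors r i) (2 * r + 1 \<in> second_successors r i) * 1
          + step_coeff (r \<in> successors r i) (r \<in> second_successors r i) * bvar
          + row_weight r i {r + 2..<2 * r + 2} * bvar + row_weight r i {1..r} * (bvar * cvar)
          + step_coeff (0 \<in> successors r i) (0 \<in> second_successors r i) * (bvar * (of_nat (r - 2) * dvar))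
          + step_coeff (1 \<in> successors r i) (1 \<in> second_successors r i) * (bvar * dvar)"
      by (simp only: row_sum_add row_sum_of_bool[of "{1..r}"] row_sum_of_bool[of "{r + 2..<2 * r + 2}"]
          singleton)
    have r2: "r - 2 = m" using m by simp
    have q: "q_entry r (2 * r + 1 - j) = cvar + of_nat (r - 1) * dvar"
      using 5 by (simp add: q_entry_def)
    have D: "D_entry r i j =
        of_bool (i = r) + of_bool (i \<in> {r + 2..<2 * r + 2}) + of_bool (i \<in> {1..r}) * cvar
        + of_bool (i = 0) * (of_nat m * dvar) + of_bool (i = 1) * dvar"
      using 5 r by (simp add: D_entry_def r2)
    show ?thesis
    proof (rule rows)
      assume 0: "i = 0"
      show ?thesis unfolding sum q D r2 unfolding 0 row_weight_values[OF r]
        using r by (simp add: expand') (simp add: m ring)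
    next
      assume 1: "i = 1"
      show ?thesis unfolding sum q D r2 unfolding 1 row_weight_values[OF r]
        using r by (simp add: expand') (simp add: m ring)
    next
      assume mid: "2 \<le> i" "i \<le> r"
      show ?thesis unfolding sum q D r2 row_weight_values(3,7)[OF r mid]
        using r mid by (simp add: expand') (simp add: m ring)
    next
      assume hi: "i = r + 1"
      then have "r < i" by simp
      show ?thesis unfolding sum q D r2 row_weight_values(4,8)[OF r \<open>r < i\<close>]
        using r hi by (simp add: expand') (simp add: m ring)
    next
      assume hi: "r + 1 < i"
      then have "r < i" by simp
      show ?thesis unfolding sum q D r2 row_weight_values(4,8)[OF r \<open>r < i\<close>]
        using r hi i by (simp add: expand') (simp add: m ring)
    qed
  qed
qed

text \<open>With \<open>q'\<close> for entry \<open>j\<close> of the row vector, the two identities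
  give \<open>(1 - t) Y = M b q phi q' + u q' + (1 - t) D = M (1 + b Y)\<close> in column
  \<open>j\<close>, and this system determines the level series.\<close>

lemma level_series_block_N:
  assumes r: "2 \<le> r" and i: "i < 2 * r + 2" and j: "j < 2 * r + 2"
  shows "level_series (block_N r) i j
    = q_entry r i * phi r * q_entry r (2 * r + 1 - j) + D_entry r i j"
proof -
  define qj where "qj = q_entry r (2 * r + 1 - j)"
  define Y where "Y i = q_entry r i * phi r * qj + D_entry r i j" for i
  have phi: "(1 - (cvar + of_nat r * dvar)) * phi r = 1"
  proof -
    have "vanishes_below 1 (cvar + of_nat r * dvar)"
      by (intro vanishes_below_add vanishes_below_mult_left vanishes_below_cvar vanishes_below_dvar)
    from inv_one_minus_unfold[OF this] show ?thesis
      unfolding phi_def left_diff_distrib by (simp add: diff_eq_eq)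
  qed
  have Y: "(1 - (avar - bvar)) * Y i = row_sum r i (\<lambda>k. of_bool (k = j) + bvar * Y k)"
    if i: "i < 2 * r + 2" for i
  proof -
    have "(1 - (avar - bvar)) * Y i
        = (1 - (avar - bvar)) * q_entry r i * (phi r * qj) + (1 - (avar - bvar)) * D_entry r i j"
      by (simp only: Y_def distrib_left mult.assoc)
    also have "(1 - (avar - bvar)) * q_entry r i
        = row_sum r i (\<lambda>k. bvar * q_entry r k) + row_factor r i * (1 - (cvar + of_nat r * dvar))"
      using row_sum_q_entry[OF r, of i] by (simp only: diff_eq_eq add.commute)
    also have "\<dots> * (phi r * qj) = row_sum r i (\<lambda>k. bvar * q_entry r k) * (phi r * qj)
        + row_factor r i * ((1 - (cvar + of_nat r * dvar)) * phi r) * qj"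
      by (simp only: distrib_right mult.assoc)
    \<comment> \<open>The right inverse \<open>phi r\<close> absorbs the factor
      \<open>1 - c - r d\<close>, and the remaining right factor moves into the column.\<close>
    also have "\<dots> = row_sum r i (\<lambda>k. bvar * q_entry r k * (phi r * qj)) + row_factor r i * qj"
      by (simp only: phi row_sum_mult_right mult_1_right)
    also have "\<dots> + (1 - (avar - bvar)) * D_entry r i j
        = row_sum r i (\<lambda>k. bvar * q_entry r k * (phi r * qj))
          + row_sum r i (\<lambda>k. of_bool (k = j) + bvar * D_entry r k j)"
      using row_sum_D_entry[OF r i j] by (simp only: qj_def add.assoc)
    also have "\<dots> = row_sum r i (\<lambda>k. of_bool (k = j) + bvar * Y k)"
      unfolding row_sum_add[symmetric] Y_def
      by (rule arg_cong[where f = "row_sum r i"]) (simp add: fun_eq_iff distrib_left mult.assoc)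
    finally show ?thesis .
  qed
  have n: "2 * r + 2 = dim_col (block_N r)"
    by (simp add: block_N_def block_A_def block_A_dagger_def)
  have "level_series (block_N r) i j = Y i"
  proof (rule level_series_eqI[OF _ n _ i j])
    show "(i, l) \<in> level_edges (block_N r) ^^ Suc k"
      if "2 \<le> k" "i < 2 * r + 2" "l < 2 * r + 2" for k i l
      using relpow_level_edges_block_N[OF r that] .
    show "(1 - (avar - bvar)) * Y i = (\<Sum>l<2 * r + 2.
        step_coeff ((i, l) \<in> level_edges (block_N r)) ((i, l) \<in> level_edges (block_N r) ^^ 2)
          * (of_bool (l = j) + bvar * Y l))" if "i < 2 * r + 2" for i
      using that by (simp only: Y row_sum_def level_edges_block_N[OF r] level_edges_block_N_2[OF r] simp_thms)
  qed
  then show ?thesis by (simp only: Y_def qj_def)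
qed

theorem proposition5p4:
  fixes r :: nat
  assumes "2 \<le> r"
  shows "level_series_mat (block_N r) = q_col r * mat 1 1 (\<lambda>_. phi r) * q_row r + D_mat r"
proof (rule eq_matI)
  have q: "q_col r \<in> carrier_mat (2 * r + 2) 1" "q_row r \<in> carrier_mat 1 (2 * r + 2)"
    unfolding q_col_def q_row_def by (rule carrier_matI; simp)+
  have D: "D_mat r \<in> carrier_mat (2 * r + 2) (2 * r + 2)"
    by (rule carrier_matI) (simp_all add: D_mat_def Let_def series_mat_def mat_times_def)
  have N: "dim_row (block_N r) = 2 * r + 2" "dim_col (block_N r) = 2 * r + 2"
    by (simp_all add: block_N_def block_A_def block_A_dagger_def)
  show "dim_row (level_series_mat (block_N r)) = dim_row (q_col r * mat 1 1 (\<lambda>_. phi r) * q_row r + D_mat r)"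
    "dim_col (level_series_mat (block_N r)) = dim_col (q_col r * mat 1 1 (\<lambda>_. phi r) * q_row r + D_mat r)"
    using D by (simp_all add: level_series_mat_def N)
  fix i j
  assume "i < dim_row (q_col r * mat 1 1 (\<lambda>_. phi r) * q_row r + D_mat r)"
    "j < dim_col (q_col r * mat 1 1 (\<lambda>_. phi r) * q_row r + D_mat r)"
  then have ij: "i < 2 * r + 2" "j < 2 * r + 2" using D by simp_all
  \<comment> \<open>Both inner dimensions are 1, so each scalar product is a single term.\<close>
  have "(q_col r * mat 1 1 (\<lambda>_. phi r) * q_row r) $$ (i, j) = q_col r $$ (i, 0) * phi r * q_row r $$ (0, j)"
    using ij q by (simp add: scalar_prod_def)
  then show "level_series_mat (block_N r) $$ (i, j)
      = (q_col r * mat 1 1 (\<lambda>_. phi r) * q_row r + D_mat r) $$ (i, j)"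
    using ij q D assms
    by (simp add: level_series_mat_def N level_series_block_N q_col_index q_row_index D_mat_index)
qed

end
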